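(* Let $T\in(0,1]$, $c\in\mathbb{R}$, $n\ge 1$, and let $$L_T(c)=\{h\in\mathcal{H}_0: h(T)=c\},$$ a closed affine subspace of the Cameron-Martin space $\mathcal{H}_0$ of classical Wiener space $(\mathcal{C}_0,\mu)$. Let $F\in L^2([0,1]^n)$ be a finite linear combination of symmetric tensor products $f_1\hat\otimes\cdots\hat\otimes f_n$, where each $f_j$ is of the form $f_j=\dot h_j$ with $h_j\in\mathcal{H}_{\mathcal{C}_0^*}$. Then the Gaussian Radon transform of the multiple It\^o integral $J_n(F)$, evaluated at $L_T(c)$, is $$GJ_n(F)\big|_{L_T(c)}=\left(\int_{[0,T]^n}F(t_1,\ldots,t_n)\,dt_1\cdots dt_n\right)H_n\!\left(\frac{c}{T};\frac1T\right).$$ In particular, for $f=\dot h$ with $h\in\mathcal{H}_{\mathcal{C}_0^*}$, $$GJ_n(f^{\otimes n})\big|_{L_T(c)}=\left(\int_0^Tf(t)\,dt\right)^nH_n\!\left(\frac cT;\frac1T\right).$$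
   Context: Classical Wiener space: $\mathcal{C}_0$ is the Banach space (sup norm) of continuous functions $\omega:[0,1]\to\mathbb{R}$ with $\omega(0)=0$; $\mu$ is standard Wiener measure on $\mathcal{C}_0$; $B_t(\omega)=\omega(t)$ is standard Brownian motion under $\mu$. $\mathcal{H}_0$ is the Hilbert space of absolutely continuous $h:[0,1]\to\mathbb{R}$ with $h(0)=0$ and $\int_0^1\dot h(t)^2dt<\infty$, with inner product $\langle h,k\rangle=\int_0^1\dot h(t)\dot k(t)\,dt$. $I:\mathcal{H}_0\to L^2(\mathcal{C}_0,\mu)$ is the isometry $I(h)=\int_0^1\dot h(t)\,dB_t$ (Wiener integral). $\mathcal{H}_{\mathcal{C}_0^*}=\{h\in\mathcal{H}_0:I(h)\in\mathcal{C}_0^*\}$, i.e. those $h$ for which $I(h)$ is ($\mu$-a.e. equal to) a continuous linear functional on $\mathcal{C}_0$; for such $h$, $I(h)$ always denotes this continuous functional. Conditioned measure and Gaussian Radon transform: for a closed affine subspace $L\subset\mathcal{H}_0$, let $h_L$ be the point of $L$ closest to $0$, $L_0=L-h_L$, and $P_{L_0}$ the orthogonal projection of $\mathcal{H}_0$ onto $L_0$. $\mu_L$ is the Borel probability measure on $\mathcal{C}_0$ with $$\int_{\mathcal{C}_0}e^{iI(h)}\,d\mu_L=e^{i\langle h_L,h\rangle-\frac12\|P_{L_0}h\|^2}\qquad\text{for all }h\in\mathcal{H}_{\mathcal{C}_0^*}$$ (its existence is known). For a (pointwise defined) measurable function $\phi$ on $\mathcal{C}_0$, the Gaussian Radon transform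 is $G\phi|_L=\int_{\mathcal{C}_0}\phi\,d\mu_L$ whenever this integral is finite. Hermite polynomials: $H_n(x;u^2)$ is defined by $e^{tx-\frac{u^2}{2}t^2}=\sum_{n=0}^\infty\frac{t^n}{n!}H_n(x;u^2)$. Symmetric tensor product: $f_1\hat\otimes\cdots\hat\otimes f_n=\frac1{n!}\sum_{\sigma\in S_n}f_{\sigma^{-1}(1)}\otimes\cdots\otimes f_{\sigma^{-1}(n)}$, where $(g_1\otimes\cdots\otimes g_n)(t_1,\ldots,t_n)=g_1(t_1)\cdots g_n(t_n)$. Multiple It\^o integral: for symmetric $F\in L^2([0,1]^n)$, $$J_n(F)=n!\int_0^1\cdots\int_0^{t_{n-2}}\Bigl[\int_0^{t_{n-1}}F(t_1,\ldots,t_n)\,dB_{t_n}\Bigr]\cdots dB_{t_1};$$ it is linear in $F$ and $J_n(f^{\otimes n})=H_n\bigl(\int_0^1f(s)\,dB_s;\|f\|^2_{L^2[0,1]}\bigr)$. For $F$ as in the claim, $J_n(F)$ is understood as its continuous version on $\mathcal{C}_0$: for $f=\dot h$ with $h\in\mathcal{H}_{\mathcal{C}_0^*}$ it is the continuous function $J_n(f^{\otimes n})=H_n(I(h);\|f\|^2_{L^2[0,1]})$, and in general it is obtained from this by linearity, since by polarization each $f_1\hat\otimes\cdots\hat\otimes f_n$ is a linear combination of powers $g^{\otimes n}$ with $g$ in the span of $f_1,\ldots,f_n$. *)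

theory Defs
  imports "HOL-Probability.Probability" "HOL-Combinatorics.Combinatorics"
begin

section \<open>The Banach space of continuous paths starting at zero\<close>

text \<open>
  Paths live on the unit interval; they are made total by the value 0 outside of it, so that
  equality of elements is equality on the unit interval.
\<close>

typedef c0 =
  "{w :: real \<Rightarrow> real. continuous_on {0..1} w \<and> w 0 = 0 \<and> (\<forall>t. t \<notin> {0..1} \<longrightarrow> w t = 0)}"
  morphisms c0_apply C0
  by (rule exI[of _ "\<lambda>_. 0"]) auto

declare [[coercion "c0_apply :: c0 \<Rightarrow> real \<Rightarrow> real"]]

setup_lifting type_definition_c0

lemma continuous_on_c0_apply [simp]: "continuous_on {0..1} (c0_apply w)"
  and c0_apply_0 [simp]: "c0_apply w 0 = 0"
  and c0_apply_outside: "t \<notin> {0..1} \<Longrightarrow> c0_apply w t = 0"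
  using c0_apply[of w] by auto

lemma c0_eqI: "(\<And>t. t \<in> {0..1} \<Longrightarrow> c0_apply v t = c0_apply w t) \<Longrightarrow> v = w"
  by (metis (no_types, lifting) c0_apply_inject c0_apply_outside ext)

instantiation c0 :: real_vector
begin

lift_definition zero_c0 :: c0 is "\<lambda>_. 0" by simp

lift_definition uminus_c0 :: "c0 \<Rightarrow> c0" is "\<lambda>v t. - v t"
  by (auto intro!: continuous_intros)

lift_definition plus_c0 :: "c0 \<Rightarrow> c0 \<Rightarrow> c0" is "\<lambda>v w t. v t + w t"
  by (auto intro!: continuous_intros)

lift_definition minus_c0 :: "c0 \<Rightarrow> c0 \<Rightarrow> c0" is "\<lambda>v w t. v t - w t"
  by (auto intro!: continuous_intros)

lift_definition scaleR_c0 :: "real \<Rightarrow> c0 \<Rightarrow> c0" is "\<lambda>r w t. r * w t"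
  by (auto intro!: continuous_intros)

lemmas c0_apply_simps [simp] =
  zero_c0.rep_eq uminus_c0.rep_eq plus_c0.rep_eq minus_c0.rep_eq scaleR_c0.rep_eq

instance
  by standard (auto intro!: c0_eqI simp: algebra_simps)

end

instantiation c0 :: real_normed_vector
begin

definition norm_c0 :: "c0 \<Rightarrow> real"
  where "norm_c0 w = (SUP t\<in>{0..1}. \<bar>w t\<bar>)"

definition dist_c0 :: "c0 \<Rightarrow> c0 \<Rightarrow> real"
  where "dist_c0 v w = norm (v - w)"

definition sgn_c0 :: "c0 \<Rightarrow> c0"
  where "sgn_c0 w = w /\<^sub>R norm w"

definition uniformity_c0 :: "(c0 \<times> c0) filter"
  where "uniformity_c0 = (INF e\<in>{0 <..}. principal {(x, y). dist x y < e})"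

definition open_c0 :: "c0 set \<Rightarrow> bool"
  where "open_c0 S = (\<forall>x\<in>S. \<forall>\<^sub>F (x', y) in uniformity. x' = x \<longrightarrow> y \<in> S)"

lemma c0_bdd_above: "bdd_above ((\<lambda>t. \<bar>c0_apply w t\<bar>) ` {0..1})"
  by (intro bounded_imp_bdd_above compact_imp_bounded compact_continuous_image
      continuous_intros continuous_on_c0_apply) auto

lemma abs_c0_apply_le_norm: "\<bar>c0_apply w t\<bar> \<le> norm w"
proof -
  have *: "\<bar>c0_apply w s\<bar> \<le> norm w" if "s \<in> {0..1}" for s
    unfolding norm_c0_def by (rule cSUP_upper[OF that c0_bdd_above])
  show ?thesis
    using *[of t] *[of 0] by (cases "t \<in> {0..1}") (auto simp: c0_apply_outside)
qed

lemma norm_c0_le: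
  assumes "\<And>t. t \<in> {0..1} \<Longrightarrow> \<bar>c0_apply w t\<bar> \<le> b"
  shows "norm w \<le> b"
  unfolding norm_c0_def using assms by (intro cSUP_least) auto

instance
proof
  fix v w :: c0 and r :: real
  show "norm w = 0 \<longleftrightarrow> w = 0"
  proof
    assume "norm w = 0"
    then show "w = 0"
      using abs_c0_apply_le_norm[of w] by (intro c0_eqI) auto
  next
    assume "w = 0"
    then have "norm w \<le> 0" by (intro norm_c0_le) auto
    then show "norm w = 0"
      using abs_c0_apply_le_norm[of w 0] by simp
  qed
  show "norm (v + w) \<le> norm v + norm w"
    by (intro norm_c0_le)
      (auto intro: order_trans[OF abs_triangle_ineq] add_mono abs_c0_apply_le_norm)
  show "norm (r *\<^sub>R w) = \<bar>r\<bar> * norm w"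
  proof (rule antisym)
    have le: "norm (s *\<^sub>R u) \<le> \<bar>s\<bar> * norm u" for s and u :: c0
      by (intro norm_c0_le) (auto simp: abs_mult intro!: mult_left_mono abs_c0_apply_le_norm)
    show "norm (r *\<^sub>R w) \<le> \<bar>r\<bar> * norm w" by (rule le)
    show "\<bar>r\<bar> * norm w \<le> norm (r *\<^sub>R w)"
    proof (cases "r = 0")
      case True
      then show ?thesis
        using abs_c0_apply_le_norm[of "r *\<^sub>R w" 0] by simp
    next
      case False
      then show ?thesis
        using le[of "inverse r" "r *\<^sub>R w"] by (simp add: field_simps)
    qed
  qed
qed (auto simp: dist_c0_def sgn_c0_def uniformity_c0_def open_c0_def)

end

instance c0 :: banach
proof
  fix X :: "nat \<Rightarrow> c0"
  assume X: "Cauchy X"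
  have "uniformly_Cauchy_on {0..1} (\<lambda>n. c0_apply (X n))"
    unfolding uniformly_Cauchy_on_def
  proof (intro allI impI)
    fix e :: real assume "e > 0"
    then obtain N where N: "\<And>m n. m \<ge> N \<Longrightarrow> n \<ge> N \<Longrightarrow> dist (X m) (X n) < e"
      using X unfolding Cauchy_def by blast
    have "dist (X m t) (X n t) \<le> dist (X m) (X n)" for m n t
      using abs_c0_apply_le_norm[of "X m - X n" t] by (simp add: dist_norm)
    then show "\<exists>M. \<forall>t\<in>{0..1}. \<forall>m\<ge>M. \<forall>n\<ge>M. dist (X m t) (X n t) < e"
      using N by (meson le_less_trans)
  qed
  then obtain f where f: "uniform_limit {0..1} (\<lambda>n. c0_apply (X n)) f sequentially"
    using Cauchy_uniformly_convergent unfolding uniformly_convergent_on_def by blast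
  define g where "g t = (if t \<in> {0..1} then f t else 0)" for t
  have "continuous_on {0..1} f"
    by (rule uniform_limit_theorem[OF _ f]) auto
  then have "continuous_on {0..1} g"
    by (subst continuous_on_cong[OF refl, of _ _ f]) (auto simp: g_def)
  moreover have "g 0 = 0"
  proof -
    have "(\<lambda>n. X n 0) \<longlonglongrightarrow> f 0"
      by (rule tendsto_uniform_limitI[OF f]) auto
    then show ?thesis
      by (simp add: g_def LIMSEQ_const_iff)
  qed
  moreover have "\<forall>t. t \<notin> {0..1} \<longrightarrow> g t = 0"
    by (simp add: g_def)
  ultimately have "c0_apply (C0 g) = g"
    by (intro C0_inverse) blast
  then obtain w where w: "c0_apply w = g"
    by blast
  have "X \<longlonglongrightarrow> w"
  proof (rule tendstoI)
    fix e :: real assume "e > 0"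
    then have "\<forall>\<^sub>F n in sequentially. \<forall>t\<in>{0..1}. dist (X n t) (f t) < e / 2"
      using uniform_limitD[OF f, of "e / 2"] by simp
    then show "\<forall>\<^sub>F n in sequentially. dist (X n) w < e"
    proof eventually_elim
      case (elim n)
      then have "norm (X n - w) \<le> e / 2"
        by (intro norm_c0_le) (auto simp: w g_def dist_real_def less_imp_le)
      then show ?case
        using \<open>e > 0\<close> by (simp add: dist_norm)
    qed
  qed
  then show "convergent X"
    by (rule convergentI)
qed

section \<open>Wiener measure\<close>

definition wiener_measure :: "c0 measure \<Rightarrow> bool" where
  "wiener_measure \<mu> \<longleftrightarrow>
     prob_space \<mu> \<and> sets \<mu> = sets borel \<and>
     (\<forall>s t. 0 \<le> s \<and> s < t \<and> t \<le> 1 \<longrightarrow>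
        distributed \<mu> lborel (\<lambda>\<omega>. \<omega> t - \<omega> s) (normal_density 0 (sqrt (t - s)))) \<and>
     (\<forall>(m::nat) \<tau>. 0 \<le> \<tau> 0 \<and> (\<forall>i<m. \<tau> i < \<tau> (Suc i)) \<and> \<tau> m \<le> 1 \<longrightarrow>
        prob_space.indep_vars \<mu> (\<lambda>_. borel) (\<lambda>i \<omega>. \<omega> (\<tau> (Suc i)) - \<omega> (\<tau> i)) {..<m})"

section \<open>The Cameron-Martin space\<close>

definition absolutely_continuous_on_interval :: "real \<Rightarrow> real \<Rightarrow> (real \<Rightarrow> real) \<Rightarrow> bool" where
  "absolutely_continuous_on_interval a b f \<longleftrightarrow>
     (\<forall>\<epsilon>>0. \<exists>\<delta>>0. \<forall>(m::nat) u v.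
        (\<forall>i<m. a \<le> u i \<and> u i \<le> v i \<and> v i \<le> b) \<and>
        disjoint_family_on (\<lambda>i. {u i<..<v i}) {..<m} \<and>
        (\<Sum>i<m. v i - u i) < \<delta> \<longrightarrow>
        (\<Sum>i<m. \<bar>f (v i) - f (u i)\<bar>) < \<epsilon>)"

text \<open>
  An absolutely continuous path is differentiable almost everywhere; at the remaining points
  \<^const>\<open>deriv\<close> takes an irrelevant value.
\<close>

definition c0_deriv :: "c0 \<Rightarrow> real \<Rightarrow> real" where
  "c0_deriv h = deriv (c0_apply h)"

definition cameron_martin :: "c0 set" where
  "cameron_martin =
     {h. absolutely_continuous_on_interval 0 1 (c0_apply h) \<and>
         integrable (lebesgue_on {0..1}) (\<lambda>t. (c0_deriv h t)\<^sup>2)}"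

definition cm_inner :: "c0 \<Rightarrow> c0 \<Rightarrow> real" where
  "cm_inner h k = (LINT t|lebesgue_on {0..1}. c0_deriv h t * c0_deriv k t)"

definition cm_norm :: "c0 \<Rightarrow> real" where
  "cm_norm h = sqrt (cm_inner h h)"

definition cm_closest_to_0 :: "c0 set \<Rightarrow> c0" where
  "cm_closest_to_0 L = (THE h. h \<in> L \<and> (\<forall>k\<in>L. cm_norm h \<le> cm_norm k))"

definition cm_proj :: "c0 set \<Rightarrow> c0 \<Rightarrow> c0" where
  "cm_proj M h = (THE p. p \<in> M \<and> (\<forall>k\<in>M. cm_inner (h - p) k = 0))"

section \<open>The Wiener integral\<close>

text \<open>
  A list of triples \<open>(a, u, v)\<close> with \<open>0 \<le> u \<le> v \<le> 1\<close> represents the step function that is the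
  sum of the \<open>a\<close>-multiples of the indicators of the intervals \<open>{u<..v}\<close>.
\<close>

definition step_list :: "(real \<times> real \<times> real) list \<Rightarrow> bool" where
  "step_list xs \<longleftrightarrow> (\<forall>(a, u, v)\<in>set xs. 0 \<le> u \<and> u \<le> v \<and> v \<le> 1)"

definition step_fun :: "(real \<times> real \<times> real) list \<Rightarrow> real \<Rightarrow> real" where
  "step_fun xs t = (\<Sum>(a, u, v)\<leftarrow>xs. a * indicator {u<..v} t)"

definition step_wiener_integral :: "(real \<times> real \<times> real) list \<Rightarrow> c0 \<Rightarrow> real" where
  "step_wiener_integral xs \<omega> = (\<Sum>(a, u, v)\<leftarrow>xs. a * (\<omega> v - \<omega> u))"

text \<open>
  \<open>is_wiener_integral \<mu> f X\<close>: the random variable \<open>X\<close> represents the Wiener integral of \<open>f\<close>,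
  which is determined only up to \<open>\<mu>\<close>-almost sure equality, as the mean square limit of the
  integrals of step functions tending to \<open>f\<close> in mean square.
\<close>

definition is_wiener_integral :: "c0 measure \<Rightarrow> (real \<Rightarrow> real) \<Rightarrow> (c0 \<Rightarrow> real) \<Rightarrow> bool" where
  "is_wiener_integral \<mu> f X \<longleftrightarrow>
     X \<in> borel_measurable \<mu> \<and>
     (\<exists>xs :: nat \<Rightarrow> (real \<times> real \<times> real) list.
        (\<forall>k. step_list (xs k)) \<and>
        (\<lambda>k. \<integral>\<^sup>+ t. ennreal ((f t - step_fun (xs k) t)\<^sup>2) \<partial>lebesgue_on {0..1}) \<longlonglongrightarrow> 0 \<and>
        (\<lambda>k. \<integral>\<^sup>+ \<omega>. ennreal ((X \<omega> - step_wiener_integral (xs k) \<omega>)\<^sup>2) \<partial>\<mu>) \<longlonglongrightarrow> 0)"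

text \<open>
  \<open>is_I_functional \<mu> h \<phi>\<close>: the continuous linear functional \<open>\<phi>\<close> is a version of the Wiener integral
  \<open>I(h)\<close>. Since Wiener measure has full support, there is at most one such \<open>\<phi>\<close>; below, statements about
  "the" functional \<open>I(h)\<close> are therefore phrased for every \<open>\<phi>\<close> with this property.
\<close>

definition is_I_functional :: "c0 measure \<Rightarrow> c0 \<Rightarrow> (c0 \<Rightarrow> real) \<Rightarrow> bool" where
  "is_I_functional \<mu> h \<phi> \<longleftrightarrow> bounded_linear \<phi> \<and> is_wiener_integral \<mu> (c0_deriv h) \<phi>"

definition cameron_martin_dual :: "c0 measure \<Rightarrow> c0 set" where
  "cameron_martin_dual \<mu> = {h \<in> cameron_martin. \<exists>\<phi>. is_I_functional \<mu> h \<phi>}"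

section \<open>Conditioned measures and the Gaussian Radon transform\<close>

definition conditioned_measure :: "c0 measure \<Rightarrow> c0 set \<Rightarrow> c0 measure \<Rightarrow> bool" where
  "conditioned_measure \<mu> L \<nu> \<longleftrightarrow>
     prob_space \<nu> \<and> sets \<nu> = sets borel \<and>
     (let h\<^sub>L = cm_closest_to_0 L; L\<^sub>0 = (\<lambda>h. h - h\<^sub>L) ` L in
      \<forall>h\<in>cameron_martin_dual \<mu>. \<forall>\<phi>. is_I_functional \<mu> h \<phi> \<longrightarrow>
        (LINT \<omega>|\<nu>. exp (\<i> * complex_of_real (\<phi> \<omega>))) =
        exp (\<i> * complex_of_real (cm_inner h\<^sub>L h) - complex_of_real ((cm_norm (cm_proj L\<^sub>0 h))\<^sup>2 / 2)))"

definition gaussian_radon_transform :: "c0 measure \<Rightarrow> (c0 \<Rightarrow> real) \<Rightarrow> real" where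
  "gaussian_radon_transform \<nu> \<Phi> = (LINT \<omega>|\<nu>. \<Phi> \<omega>)"

definition level_subspace :: "real \<Rightarrow> real \<Rightarrow> c0 set" where
  "level_subspace T c = {h \<in> cameron_martin. h T = c}"

section \<open>Hermite polynomials\<close>

text \<open>\<open>hermite n x v\<close> is the Hermite polynomial with parameter \<open>v = u\<^sup>2\<close>.\<close>

definition hermite :: "nat \<Rightarrow> real \<Rightarrow> real \<Rightarrow> real" where
  "hermite n x v =
     (THE H :: nat \<Rightarrow> real. \<forall>t. (\<lambda>k. t ^ k / fact k * H k) sums exp (t * x - v / 2 * t\<^sup>2)) n"

section \<open>Tensor products and multiple Ito integrals\<close>

text \<open>
  A point of the cube \<open>[0,1]\<^sup>n\<close> is a function on \<open>{..<n}\<close>; the completion of the product measure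
  is \<open>n\<close>-dimensional Lebesgue measure.
\<close>

definition lebesgue_cube :: "nat \<Rightarrow> (nat \<Rightarrow> real) measure" where
  "lebesgue_cube n = completion (\<Pi>\<^sub>M i\<in>{..<n}. lebesgue_on {0..1})"

definition L2_cube :: "nat \<Rightarrow> ((nat \<Rightarrow> real) \<Rightarrow> real) set" where
  "L2_cube n = {F \<in> borel_measurable (lebesgue_cube n). integrable (lebesgue_cube n) (\<lambda>t. (F t)\<^sup>2)}"

definition tensor :: "nat \<Rightarrow> (nat \<Rightarrow> real \<Rightarrow> real) \<Rightarrow> (nat \<Rightarrow> real) \<Rightarrow> real" where
  "tensor n g t = (\<Prod>j<n. g j (t j))"

definition sym_tensor :: "nat \<Rightarrow> (nat \<Rightarrow> real \<Rightarrow> real) \<Rightarrow> (nat \<Rightarrow> real) \<Rightarrow> real" where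
  "sym_tensor n f t =
     1 / fact n * (\<Sum>\<sigma> | \<sigma> permutes {..<n}. tensor n (\<lambda>j. f (inv \<sigma> j)) t)"

abbreviation tensor_power :: "nat \<Rightarrow> (real \<Rightarrow> real) \<Rightarrow> (nat \<Rightarrow> real) \<Rightarrow> real" where
  "tensor_power n f \<equiv> tensor n (\<lambda>_. f)"

definition sym_tensor_combination :: "c0 measure \<Rightarrow> nat \<Rightarrow> ((nat \<Rightarrow> real) \<Rightarrow> real) \<Rightarrow> bool" where
  "sym_tensor_combination \<mu> n F \<longleftrightarrow>
     (\<exists>(m::nat) (a :: nat \<Rightarrow> real) (h :: nat \<Rightarrow> nat \<Rightarrow> c0).
        (\<forall>k<m. \<forall>j<n. h k j \<in> cameron_martin_dual \<mu>) \<and>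
        (AE t in lebesgue_cube n. F t = (\<Sum>k<m. a k * sym_tensor n (\<lambda>j. c0_deriv (h k j)) t)))"

text \<open>
  \<open>is_multiple_ito \<mu> n F \<Phi>\<close>: \<open>\<Phi>\<close> is the continuous version of \<open>J\<^sub>n(F)\<close>. On a power \<open>f\<^sup>\<otimes>\<^sup>n\<close> with
  \<open>f\<close> the derivative of an element \<open>h\<close> of \<^const>\<open>cameron_martin_dual\<close> this is the continuous function
  \<open>H\<^sub>n(I(h); \<parallel>f\<parallel>\<^sup>2)\<close>, and it is extended linearly to the span of these powers.
\<close>

definition is_multiple_ito ::
    "c0 measure \<Rightarrow> nat \<Rightarrow> ((nat \<Rightarrow> real) \<Rightarrow> real) \<Rightarrow> (c0 \<Rightarrow> real) \<Rightarrow> bool" where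
  "is_multiple_ito \<mu> n F \<Phi> \<longleftrightarrow>
     (\<exists>(m::nat) (a :: nat \<Rightarrow> real) (h :: nat \<Rightarrow> c0) (\<phi> :: nat \<Rightarrow> c0 \<Rightarrow> real).
        (\<forall>k<m. h k \<in> cameron_martin_dual \<mu> \<and> is_I_functional \<mu> (h k) (\<phi> k)) \<and>
        (AE t in lebesgue_cube n. F t = (\<Sum>k<m. a k * tensor_power n (c0_deriv (h k)) t)) \<and>
        (\<forall>\<omega>. \<Phi> \<omega> = (\<Sum>k<m. a k * hermite n (\<phi> k \<omega>)
                        (LINT t|lebesgue_on {0..1}. (c0_deriv (h k) t)\<^sup>2))))"

end

theory Submission
  imports Defs
begin

text \<open>
  The path \<open>e t = min t T\<close> reproduces evaluation at \<open>T\<close>: by the fundamental theorem of calculus for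
  absolutely continuous functions, \<open>\<langle>e, h\<rangle> = h T\<close>. Hence \<open>(c / T) e\<close> is the point of \<open>L_T(c)\<close> closest to 0,
  and the projection of \<open>h\<close> to the directions of \<open>L_T(c)\<close> is \<open>h - (h T / T) e\<close>. So under \<open>\<nu>\<close> the functional
  \<open>I(h)\<close> is Gaussian with mean \<open>c h(T) / T\<close> and variance \<open>\<parallel>h\<parallel>\<^sup>2 - h(T)\<^sup>2 / T\<close>. Averaging a Hermite
  polynomial over a Gaussian shifts its parameter by the variance, which is seen on the exponential
  generating functions, so that the mean of \<open>H_n(I(h); \<parallel>h\<parallel>\<^sup>2)\<close> is
  \<open>H_n(c h(T) / T; h(T)\<^sup>2 / T) = h(T)^n H_n(c / T; 1 / T)\<close>. As \<open>h(T)\<close> is the integral of the derivative of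
  \<open>h\<close> over \<open>[0,T]\<close>, this is the claim for powers; the general case follows by linearity and polarization.
\<close>

section \<open>Absolutely continuous functions\<close>

text \<open>The obstacle is \<open>c0_deriv\<close>: it is the pointwise \<open>deriv\<close>,
  whereas absolute continuity is an epsilon-delta condition. So
  \<open>\<langle>e, h\<rangle> = h T\<close> requires both that the path has a density and that
  this density is its derivative almost everywhere. The density comes from the Jordan decomposition:
  a bounded monotone absolutely continuous function is the distribution function of a finite measure
  without Lebesgue-singular part, to which Radon-Nikodym applies.

  The defining formula of \<open>\<nu>\<close> at \<open>h\<close> gives the characteristic function
  of \<open>I(h)\<close> only at the argument 1. The other arguments \<open>s\<close> are obtained
  by reading the formula at the multiples \<open>s h\<close>; this is where linearity of the Wiener
  integral enters.

  \<open>J_n(F)\<close> is described through a representation of \<open>F\<close> by powers, which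
  is far from unique. All representations lead to the same value, because the coefficient
  \<open>\<Sum> a_k h_k(T)^n\<close> that one of them produces is the integral of \<open>F\<close>
  over the cube of side \<open>T\<close>. That a representation exists is polarization, carried out
  with Ryser's formula for permanents.\<close>

definition interval_family :: "'i set \<Rightarrow> ('i \<Rightarrow> real) \<Rightarrow> ('i \<Rightarrow> real) \<Rightarrow> bool" where
  "interval_family I u v \<longleftrightarrow>
     finite I \<and> (\<forall>i\<in>I. u i \<le> v i) \<and> disjoint_family_on (\<lambda>i. {u i<..<v i}) I"

text \<open>Absolute continuity on the whole line. Intervals may lie anywhere, so cutting and
  refining families never has to respect the ends of a domain; functions on the unit interval enter
  through clamping.\<close>

definition ac_real :: "(real \<Rightarrow> real) \<Rightarrow> bool" where
  "ac_real f \<longleftrightarrow>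
     (\<forall>\<epsilon>>0. \<exists>\<delta>>0. \<forall>(m::nat) u v. interval_family {..<m} u v \<and> (\<Sum>i<m. v i - u i) < \<delta> \<longrightarrow>
        (\<Sum>i<m. \<bar>f (v i) - f (u i)\<bar>) < \<epsilon>)"

lemma interval_family_shrink:
  assumes "interval_family I u v"
    and "\<And>i. i \<in> I \<Longrightarrow> u' i \<le> v' i"
    and "\<And>i. i \<in> I \<Longrightarrow> {u' i<..<v' i} \<subseteq> {u i<..<v i}"
  shows "interval_family I u' v'"
  unfolding interval_family_def disjoint_family_on_def
proof (intro conjI ballI impI)
  show "finite I" using assms(1) by (simp add: interval_family_def)
  fix i j assume "i \<in> I" "j \<in> I" "i \<noteq> j"
  then have "{u i<..<v i} \<inter> {u j<..<v j} = {}"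
    using assms(1) by (simp add: interval_family_def disjoint_family_on_def)
  then show "{u' i<..<v' i} \<inter> {u' j<..<v' j} = {}"
    using assms(3)[OF \<open>i \<in> I\<close>] assms(3)[OF \<open>j \<in> I\<close>] by blast
qed (use assms(2) in blast)

lemma interval_family_min:
  assumes "interval_family I u v"
  shows "interval_family I (\<lambda>i. min b (u i)) (\<lambda>i. min b (v i))"
  using assms by (rule interval_family_shrink)
    (use assms in \<open>auto simp: interval_family_def intro: min.coboundedI2\<close>)

lemma interval_family_max:
  assumes "interval_family I u v"
  shows "interval_family I (\<lambda>i. max a (u i)) (\<lambda>i. max a (v i))"
  using assms by (rule interval_family_shrink)
    (use assms in \<open>auto simp: interval_family_def intro: max.coboundedI2\<close>)

lemma interval_family_length_le:
  assumes "interval_family I u v" and "\<And>i. i \<in> I \<Longrightarrow> a \<le> u i \<and> v i \<le> b" and "a \<le> b"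
  shows "(\<Sum>i\<in>I. v i - u i) \<le> b - a"
proof -
  have "(\<Sum>i\<in>I. v i - u i) = (\<Sum>i\<in>I. measure lborel {u i<..<v i})"
    using assms by (intro sum.cong) (auto simp: interval_family_def)
  also have "\<dots> = measure lborel (\<Union>i\<in>I. {u i<..<v i})"
    using assms unfolding interval_family_def
    by (intro measure_finite_Union[symmetric]) auto
  also have "\<dots> \<le> measure lborel {a..b}"
    using assms unfolding interval_family_def
    by (intro measure_mono_fmeasurable) (auto intro!: sets.finite_UN fmeasurableI, force+)
  finally show ?thesis
    using assms by simp
qed

text \<open>Enumerating the finite index set reduces this to an initial segment of the naturals.
  Below, pairs index refinements of a family and integers index the cells of a grid.\<close>

lemma ac_real_family:
  fixes f :: "real \<Rightarrow> real"
  assumes "ac_real f" and "\<epsilon> > 0"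
  obtains \<delta> where "\<delta> > 0"
    and "\<And>(I::'i set) u v. interval_family I u v \<Longrightarrow> (\<Sum>i\<in>I. v i - u i) < \<delta> \<Longrightarrow>
           (\<Sum>i\<in>I. \<bar>f (v i) - f (u i)\<bar>) < \<epsilon>"
proof -
  obtain \<delta> where "\<delta> > 0"
    and \<delta>: "\<And>(m::nat) u v. interval_family {..<m} u v \<Longrightarrow> (\<Sum>i<m. v i - u i) < \<delta> \<Longrightarrow>
        (\<Sum>i<m. \<bar>f (v i) - f (u i)\<bar>) < \<epsilon>"
    using assms unfolding ac_real_def by meson
  show ?thesis
  proof (rule that[OF \<open>\<delta> > 0\<close>])
    fix I :: "'i set" and u v
    assume I: "interval_family I u v" "(\<Sum>i\<in>I. v i - u i) < \<delta>"
    obtain e where e: "bij_betw e {..<card I} I"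
      using I ex_bij_betw_nat_finite unfolding interval_family_def lessThan_atLeast0 by blast
    have "interval_family {..<card I} (u \<circ> e) (v \<circ> e)"
      unfolding interval_family_def disjoint_family_on_def
    proof (intro conjI ballI impI)
      fix i j assume ij: "i \<in> {..<card I}" "j \<in> {..<card I}" "i \<noteq> j"
      then have "e i \<in> I" "e j \<in> I" "e i \<noteq> e j"
        using bij_betwE[OF e] bij_betw_imp_inj_on[OF e] by (auto dest: inj_onD)
      then show "{(u \<circ> e) i<..<(v \<circ> e) i} \<inter> {(u \<circ> e) j<..<(v \<circ> e) j} = {}"
        using I(1) unfolding interval_family_def disjoint_family_on_def comp_def by blast
    qed (use I(1) bij_betwE[OF e] in \<open>auto simp: interval_family_def\<close>)
    moreover have "(\<Sum>i<card I. (v \<circ> e) i - (u \<circ> e) i) < \<delta>"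
      using sum.reindex_bij_betw[OF e, of "\<lambda>i. v i - u i"] I(2) by simp
    ultimately have "(\<Sum>i<card I. \<bar>f ((v \<circ> e) i) - f ((u \<circ> e) i)\<bar>) < \<epsilon>"
      by (rule \<delta>)
    then show "(\<Sum>i\<in>I. \<bar>f (v i) - f (u i)\<bar>) < \<epsilon>"
      using sum.reindex_bij_betw[OF e, of "\<lambda>i. \<bar>f (v i) - f (u i)\<bar>"] by simp
  qed
qed

text \<open>Clamping is monotone and 1-Lipschitz: it maps a family to a family inside the unit
  interval of no larger total length.\<close>

lemma ac_real_clamp:
  assumes "absolutely_continuous_on_interval 0 1 f"
  shows "ac_real (\<lambda>x. f (max 0 (min 1 x)))"
  unfolding ac_real_def
proof (intro allI impI)
  fix \<epsilon> :: real assume "\<epsilon> > 0"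
  then obtain \<delta> where "\<delta> > 0"
    and \<delta>: "\<And>(m::nat) u v. (\<forall>i<m. 0 \<le> u i \<and> u i \<le> v i \<and> v i \<le> 1) \<Longrightarrow>
        disjoint_family_on (\<lambda>i. {u i<..<v i}) {..<m} \<Longrightarrow> (\<Sum>i<m. v i - u i) < \<delta> \<Longrightarrow>
        (\<Sum>i<m. \<bar>f (v i) - f (u i)\<bar>) < \<epsilon>"
    using assms unfolding absolutely_continuous_on_interval_def by meson
  have "(\<Sum>i<m. \<bar>f (max 0 (min 1 (v i))) - f (max 0 (min 1 (u i)))\<bar>) < \<epsilon>"
    if fam: "interval_family {..<m} u v" "(\<Sum>i<m. v i - u i) < \<delta>" for m :: nat and u v
  proof (rule \<delta>)
    have "interval_family {..<m} (\<lambda>i. max 0 (min 1 (u i))) (\<lambda>i. max 0 (min 1 (v i)))"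
      by (intro interval_family_max interval_family_min fam(1))
    then show "\<forall>i<m. 0 \<le> max 0 (min 1 (u i)) \<and> max 0 (min 1 (u i)) \<le> max 0 (min 1 (v i)) \<and>
        max 0 (min 1 (v i)) \<le> 1"
      and "disjoint_family_on (\<lambda>i. {max 0 (min 1 (u i))<..<max 0 (min 1 (v i))}) {..<m}"
      by (simp_all add: interval_family_def)
    have "(\<Sum>i<m. max 0 (min 1 (v i)) - max 0 (min 1 (u i))) \<le> (\<Sum>i<m. v i - u i)"
      by (rule sum_mono) (use fam(1) in \<open>force simp: interval_family_def\<close>)
    then show "(\<Sum>i<m. max 0 (min 1 (v i)) - max 0 (min 1 (u i))) < \<delta>"
      using fam(2) by linarith
  qed
  then show "\<exists>\<delta>>0. \<forall>(m::nat) u v. interval_family {..<m} u v \<and> (\<Sum>i<m. v i - u i) < \<delta> \<longrightarrow>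
        (\<Sum>i<m. \<bar>f (max 0 (min 1 (v i))) - f (max 0 (min 1 (u i)))\<bar>) < \<epsilon>"
    using \<open>\<delta> > 0\<close> by blast
qed

text \<open>On each cell of a grid of mesh below \<open>\<delta>\<close> a family contributes at most 1.\<close>

lemma ac_real_bounded_variation:
  assumes f: "ac_real f" and const: "\<And>x. x \<le> 0 \<Longrightarrow> f x = f 0" "\<And>x. x \<ge> 1 \<Longrightarrow> f x = f 1"
  obtains B where "\<And>(m::nat) u v. interval_family {..<m} u v \<Longrightarrow> (\<Sum>i<m. \<bar>f (v i) - f (u i)\<bar>) \<le> B"
proof -
  obtain \<delta> where "\<delta> > 0"
    and \<delta>: "\<And>(I::nat set) u v. interval_family I u v \<Longrightarrow> (\<Sum>i\<in>I. v i - u i) < \<delta> \<Longrightarrow>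
        (\<Sum>i\<in>I. \<bar>f (v i) - f (u i)\<bar>) < 1"
    using ac_real_family[OF f, of 1, where ?'i = nat] by (metis zero_less_one)
  obtain N :: nat where N: "N > 0" "1 / N < \<delta>"
    using \<open>\<delta> > 0\<close> by (metis nat_approx_posE zero_less_Suc)
  have bound: "(\<Sum>i<m. \<bar>f (min (k / N) (v i)) - f (min (k / N) (u i))\<bar>) \<le> k"
    if fam: "interval_family {..<m} u v" for m k :: nat and u v
  proof (induction k)
    case 0
    then show ?case
      using const(1)[of "min 0 _"] by simp
  next
    case (Suc k)
    let ?a = "k / N" and ?b = "Suc k / N"
    have ab: "?a \<le> ?b" "?b - ?a = 1 / N"
      using N(1) by (auto simp: field_simps)
    let ?c = "\<lambda>x. max ?a (min ?b x)"
    have fam': "interval_family {..<m} (\<lambda>i. ?c (u i)) (\<lambda>i. ?c (v i))"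
      by (intro interval_family_max interval_family_min fam)
    have "(\<Sum>i<m. \<bar>f (?c (v i)) - f (?c (u i))\<bar>) < 1"
      using interval_family_length_le[OF fam', of ?a ?b] ab N(2) by (intro \<delta>[OF fam']) auto
    moreover have "f (min ?b (v i)) - f (min ?b (u i)) =
        (f (min ?a (v i)) - f (min ?a (u i))) + (f (?c (v i)) - f (?c (u i)))" for i
      using ab(1) by (auto simp: min_def max_def)
    then have "(\<Sum>i<m. \<bar>f (min ?b (v i)) - f (min ?b (u i))\<bar>) \<le>
        (\<Sum>i<m. \<bar>f (min ?a (v i)) - f (min ?a (u i))\<bar>) + (\<Sum>i<m. \<bar>f (?c (v i)) - f (?c (u i))\<bar>)"
      unfolding sum.distrib[symmetric] by (intro sum_mono) (simp only: abs_triangle_ineq)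
    ultimately show ?case
      using Suc.IH by simp
  qed
  \<comment> \<open>The cut at \<open>N / N = 1\<close> loses nothing because \<open>f\<close> is
    constant from 1 on, so \<open>N\<close> itself is the bound.\<close>
  have "f (min 1 x) = f x" for x
    using const(2)[of x] by (cases "x \<ge> 1") auto
  then show ?thesis
    using bound[of _ _ _ N] N(1) that[of N] by simp
qed

section \<open>Positive variation and the Jordan decomposition\<close>

definition pos_variation :: "(real \<Rightarrow> real) \<Rightarrow> real \<Rightarrow> real" where
  "pos_variation f x =
     Sup {(\<Sum>i<m. f (v i) - f (u i)) |(m::nat) u v. interval_family {..<m} u v \<and> (\<forall>i<m. v i \<le> x)}"

context
  fixes f :: "real \<Rightarrow> real" and B :: real
  assumes bv: "\<And>(m::nat) u v. interval_family {..<m} u v \<Longrightarrow> (\<Sum>i<m. \<bar>f (v i) - f (u i)\<bar>) \<le> B"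
begin

lemma pos_variation_upper:
  assumes "interval_family {..<m} u v" "\<And>i. i < (m::nat) \<Longrightarrow> v i \<le> x"
  shows "(\<Sum>i<m. f (v i) - f (u i)) \<le> pos_variation f x"
  unfolding pos_variation_def
proof (rule cSup_upper)
  show "bdd_above {(\<Sum>i<m. f (v i) - f (u i)) |(m::nat) u v. interval_family {..<m} u v \<and> (\<forall>i<m. v i \<le> x)}"
    by (rule bdd_aboveI[of _ B]) (auto intro!: order_trans[OF sum_mono bv])
qed (use assms in blast)

lemma pos_variation_least:
  assumes "\<And>(m::nat) u v. interval_family {..<m} u v \<Longrightarrow> (\<And>i. i < m \<Longrightarrow> v i \<le> x) \<Longrightarrow>
      (\<Sum>i<m. f (v i) - f (u i)) \<le> b"
  shows "pos_variation f x \<le> b"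
  unfolding pos_variation_def
proof (rule cSup_least)
  have "interval_family {..<0::nat} (\<lambda>_. 0) (\<lambda>_. 0)"
    by (simp add: interval_family_def disjoint_family_on_def)
  then show "{(\<Sum>i<m. f (v i) - f (u i)) |(m::nat) u v. interval_family {..<m} u v \<and> (\<forall>i<m. v i \<le> x)} \<noteq> {}"
    by blast
qed (use assms in blast)

lemma pos_variation_mono: "x \<le> y \<Longrightarrow> pos_variation f x \<le> pos_variation f y"
  by (rule pos_variation_least, rule pos_variation_upper) (auto intro: order_trans)

lemma pos_variation_le: "pos_variation f x \<le> B"
  by (rule pos_variation_least) (auto intro!: order_trans[OF sum_mono bv])

lemma pos_variation_nonneg: "pos_variation f x \<ge> 0"
  using pos_variation_upper[of 0 "\<lambda>_. 0" "\<lambda>_. 0" x]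
  by (simp add: interval_family_def disjoint_family_on_def)

text \<open>The interval from \<open>x\<close> to \<open>y\<close> can be appended to any family
  that ends before \<open>x\<close>. Equivalently, \<open>pos_variation f - f\<close> is
  nondecreasing, which makes it the second part of the Jordan decomposition.\<close>

lemma pos_variation_increment_ge:
  assumes "x \<le> y"
  shows "f y - f x \<le> pos_variation f y - pos_variation f x"
proof -
  have "pos_variation f x \<le> pos_variation f y - (f y - f x)"
  proof (rule pos_variation_least)
    fix m :: nat and u v
    assume fam: "interval_family {..<m} u v" and le: "\<And>i. i < m \<Longrightarrow> v i \<le> x"
    let ?u = "u(m := x)" and ?v = "v(m := y)"
    have "interval_family {..<Suc m} ?u ?v"
      using fam le assms unfolding interval_family_def disjoint_family_on_def lessThan_Suc
      by fastforce
    from pos_variation_upper[OF this, of y] le assms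
    show "(\<Sum>i<m. f (v i) - f (u i)) \<le> pos_variation f y - (f y - f x)"
      by (fastforce simp: less_Suc_eq)
  qed
  then show ?thesis by simp
qed

text \<open>
  Cutting every interval at \<open>y\<close> splits a sum over a family exactly into a sum over a family to the
  left of \<open>y\<close> and one over a family to the right of \<open>y\<close>.
\<close>

lemma pos_variation_increment_approx:
  assumes "y \<le> z" "e > 0"
  shows "\<exists>(m::nat) u v. interval_family {..<m} u v \<and> (\<forall>i<m. y \<le> u i \<and> v i \<le> z) \<and>
    pos_variation f z - pos_variation f y < (\<Sum>i<m. f (v i) - f (u i)) + e"
proof (rule ccontr)
  assume neg: "\<not> ?thesis"
  \<comment> \<open>If no family between \<open>y\<close> and \<open>z\<close> came within
    \<open>e\<close> of the increment, then the part of any family to the right of \<open>y\<close>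
    would fall short by \<open>e\<close>, and so would every sum in the supremum defining
    \<open>pos_variation f z\<close>.\<close>
  have "pos_variation f z \<le> pos_variation f z - e"
  proof (rule pos_variation_least)
    fix m :: nat and u v
    assume fam: "interval_family {..<m} u v" and le: "\<And>i. i < m \<Longrightarrow> v i \<le> z"
    have 1: "interval_family {..<m} (\<lambda>i. min y (u i)) (\<lambda>i. min y (v i))"
      by (rule interval_family_min[OF fam])
    have 2: "interval_family {..<m} (\<lambda>i. max y (u i)) (\<lambda>i. max y (v i))"
      by (rule interval_family_max[OF fam])
    have "(\<Sum>i<m. f (v i) - f (u i)) = (\<Sum>i<m. f (min y (v i)) - f (min y (u i))) +
        (\<Sum>i<m. f (max y (v i)) - f (max y (u i)))"
      unfolding sum.distrib[symmetric] by (intro sum.cong) (auto simp: min_def max_def)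
    moreover have "(\<Sum>i<m. f (min y (v i)) - f (min y (u i))) \<le> pos_variation f y"
      by (rule pos_variation_upper[OF 1]) simp
    moreover have "(\<Sum>i<m. f (max y (v i)) - f (max y (u i))) + e \<le> pos_variation f z - pos_variation f y"
    proof -
      have "\<forall>i<m. y \<le> max y (u i) \<and> max y (v i) \<le> z"
        using le assms(1) by auto
      then have "\<not> pos_variation f z - pos_variation f y <
          (\<Sum>i<m. f (max y (v i)) - f (max y (u i))) + e"
        using neg 2 by blast
      then show ?thesis by simp
    qed
    ultimately show "(\<Sum>i<m. f (v i) - f (u i)) \<le> pos_variation f z - e"
      by linarith
  qed
  with \<open>e > 0\<close> show False by simp
qed

text \<open>Inside each interval of a short family the increment of the positive variation is nearly
  attained by the increments of \<open>f\<close> over a subfamily. Together the subfamilies form one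
  family, indexed by pairs, that is no longer than the given one, so absolute continuity of
  \<open>f\<close> bounds the total.\<close>

lemma ac_real_pos_variation:
  assumes "ac_real f"
  shows "ac_real (pos_variation f)"
  unfolding ac_real_def
proof (intro allI impI)
  let ?P = "pos_variation f"
  fix \<epsilon> :: real assume "\<epsilon> > 0"
  then have "\<epsilon> / 2 > 0" by simp
  then obtain \<delta> where "\<delta> > 0"
    and \<delta>: "\<And>(I::(nat \<times> nat) set) u v. interval_family I u v \<Longrightarrow> (\<Sum>i\<in>I. v i - u i) < \<delta> \<Longrightarrow>
        (\<Sum>i\<in>I. \<bar>f (v i) - f (u i)\<bar>) < \<epsilon> / 2"
    using ac_real_family[OF assms, of "\<epsilon> / 2", where ?'i = "nat \<times> nat"] by metis
  have "(\<Sum>i<m. \<bar>?P (v i) - ?P (u i)\<bar>) < \<epsilon>"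
    if fam: "interval_family {..<m} u v" "(\<Sum>i<m. v i - u i) < \<delta>" for m :: nat and u v
  proof -
    \<comment> \<open>The \<open>m\<close> approximation errors then add up to at most
      \<open>\<epsilon> / 2\<close>; \<open>m + 1\<close> keeps the denominator positive when
      \<open>m = 0\<close>.\<close>
    define e where "e = \<epsilon> / (2 * (m + 1))"
    have "e > 0" using \<open>\<epsilon> > 0\<close> by (simp add: e_def)
    have le: "u i \<le> v i" if "i < m" for i
      using fam(1) that by (simp add: interval_family_def)
    define approx where "approx = (\<lambda>i (k::nat) U V. interval_family {..<k} U V \<and>
        (\<forall>j<k. u i \<le> U j \<and> V j \<le> v i) \<and> ?P (v i) - ?P (u i) < (\<Sum>j<k. f (V j) - f (U j)) + e)"
    have "\<exists>k U V. approx i k U V" if "i < m" for i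
      unfolding approx_def by (rule pos_variation_increment_approx[OF le[OF that] \<open>e > 0\<close>])
    then obtain k U V where "\<And>i. i < m \<Longrightarrow> approx i (k i) (U i) (V i)"
      by metis
    then have sub: "\<And>i. i < m \<Longrightarrow> interval_family {..<k i} (U i) (V i)"
      and in_uv: "\<And>i j. i < m \<Longrightarrow> j < k i \<Longrightarrow> u i \<le> U i j \<and> V i j \<le> v i"
      and approx: "\<And>i. i < m \<Longrightarrow> ?P (v i) - ?P (u i) < (\<Sum>j<k i. f (V i j) - f (U i j)) + e"
      by (auto simp: approx_def)
    let ?I = "Sigma {..<m} (\<lambda>i. {..<k i})"
    let ?U = "\<lambda>(i, j). U i j" and ?V = "\<lambda>(i, j). V i j"
    have "disjoint_family_on (\<lambda>p. {?U p<..<?V p}) ?I"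
      unfolding disjoint_family_on_def
    proof (intro ballI impI)
      fix p q assume p: "p \<in> ?I" and q: "q \<in> ?I" and "p \<noteq> q"
      obtain i j i' j' where pq: "p = (i, j)" "q = (i', j')" by fastforce
      show "{?U p<..<?V p} \<inter> {?U q<..<?V q} = {}"
      proof (cases "i = i'")
        case True
        then show ?thesis
          using sub[of i] p q pq \<open>p \<noteq> q\<close> by (auto simp: interval_family_def disjoint_family_on_def)
      next
        case False
        then have "{u i<..<v i} \<inter> {u i'<..<v i'} = {}"
          using fam(1) p q pq by (auto simp: interval_family_def disjoint_family_on_def)
        moreover have "{?U p<..<?V p} \<subseteq> {u i<..<v i}" "{?U q<..<?V q} \<subseteq> {u i'<..<v i'}"
          using in_uv[of i j] in_uv[of i' j'] p q pq by auto
        ultimately show ?thesis by blast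
      qed
    qed
    then have famI: "interval_family ?I ?U ?V"
      using sub by (auto simp: interval_family_def)
    have "(\<Sum>p\<in>?I. ?V p - ?U p) = (\<Sum>i<m. \<Sum>j<k i. V i j - U i j)"
      by (subst sum.Sigma) (auto simp: split_def)
    also have "\<dots> \<le> (\<Sum>i<m. v i - u i)"
      using in_uv le by (intro sum_mono interval_family_length_le sub) auto
    finally have small: "(\<Sum>p\<in>?I. \<bar>f (?V p) - f (?U p)\<bar>) < \<epsilon> / 2"
      using fam(2) by (intro \<delta>[OF famI]) simp
    have "(\<Sum>i<m. \<bar>?P (v i) - ?P (u i)\<bar>) \<le> (\<Sum>i<m. (\<Sum>j<k i. \<bar>f (V i j) - f (U i j)\<bar>) + e)"
    proof (rule sum_mono)
      fix i assume "i \<in> {..<m}"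
      then have i: "i < m" by simp
      have "\<bar>?P (v i) - ?P (u i)\<bar> = ?P (v i) - ?P (u i)"
        using pos_variation_mono[OF le[OF i]] by simp
      also have "\<dots> \<le> (\<Sum>j<k i. f (V i j) - f (U i j)) + e"
        using approx[OF i] by simp
      also have "\<dots> \<le> (\<Sum>j<k i. \<bar>f (V i j) - f (U i j)\<bar>) + e"
        by (intro add_right_mono sum_mono) simp
      finally show "\<bar>?P (v i) - ?P (u i)\<bar> \<le> (\<Sum>j<k i. \<bar>f (V i j) - f (U i j)\<bar>) + e" .
    qed
    also have "\<dots> = (\<Sum>p\<in>?I. \<bar>f (?V p) - f (?U p)\<bar>) + m * e"
      unfolding sum.distrib by (subst sum.Sigma) (auto simp: split_def)
    also have "m * e \<le> \<epsilon> / 2"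
      using \<open>\<epsilon> > 0\<close> by (simp add: e_def field_simps)
    finally show ?thesis
      using small by linarith
  qed
  then show "\<exists>\<delta>>0. \<forall>(m::nat) u v. interval_family {..<m} u v \<and> (\<Sum>i<m. v i - u i) < \<delta> \<longrightarrow>
      (\<Sum>i<m. \<bar>?P (v i) - ?P (u i)\<bar>) < \<epsilon>"
    using \<open>\<delta> > 0\<close> by blast
qed

end

lemma ac_real_continuous:
  assumes "ac_real f"
  shows "isCont f x"
  unfolding continuous_at_eps_delta
proof (intro allI impI)
  fix e :: real assume "e > 0"
  then obtain \<delta> where "\<delta> > 0"
    and \<delta>: "\<And>(I::nat set) u v. interval_family I u v \<Longrightarrow> (\<Sum>i\<in>I. v i - u i) < \<delta> \<Longrightarrow>
        (\<Sum>i\<in>I. \<bar>f (v i) - f (u i)\<bar>) < e"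
    using ac_real_family[OF assms, of e, where ?'i = nat] by metis
  have "dist (f y) (f x) < e" if "dist y x < \<delta>" for y
    using \<delta>[of "{0}" "\<lambda>_. min x y" "\<lambda>_. max x y"] that
    by (cases "x \<le> y") (auto simp: interval_family_def disjoint_family_on_def dist_real_def abs_minus_commute)
  then show "\<exists>d>0. \<forall>y. dist y x < d \<longrightarrow> dist (f y) (f x) < e"
    using \<open>\<delta> > 0\<close> by blast
qed

lemma ac_real_diff:
  assumes "ac_real f" "ac_real g"
  shows "ac_real (\<lambda>x. f x - g x)"
  unfolding ac_real_def
proof (intro allI impI)
  fix \<epsilon> :: real assume "\<epsilon> > 0"
  then have "\<epsilon> / 2 > 0" by simp
  obtain d1 where d1: "d1 > 0" "\<And>(I::nat set) u v. interval_family I u v \<Longrightarrow> (\<Sum>i\<in>I. v i - u i) < d1 \<Longrightarrow>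
        (\<Sum>i\<in>I. \<bar>f (v i) - f (u i)\<bar>) < \<epsilon> / 2"
    using ac_real_family[OF assms(1) \<open>\<epsilon> / 2 > 0\<close>, where ?'i = nat] by metis
  obtain d2 where d2: "d2 > 0" "\<And>(I::nat set) u v. interval_family I u v \<Longrightarrow> (\<Sum>i\<in>I. v i - u i) < d2 \<Longrightarrow>
        (\<Sum>i\<in>I. \<bar>g (v i) - g (u i)\<bar>) < \<epsilon> / 2"
    using ac_real_family[OF assms(2) \<open>\<epsilon> / 2 > 0\<close>, where ?'i = nat] by metis
  have "(\<Sum>i<m. \<bar>f (v i) - g (v i) - (f (u i) - g (u i))\<bar>) < \<epsilon>"
    if fam: "interval_family {..<m} u v" "(\<Sum>i<m. v i - u i) < min d1 d2" for m :: nat and u v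
  proof -
    have "(\<Sum>i<m. \<bar>f (v i) - g (v i) - (f (u i) - g (u i))\<bar>) \<le>
        (\<Sum>i<m. \<bar>f (v i) - f (u i)\<bar>) + (\<Sum>i<m. \<bar>g (v i) - g (u i)\<bar>)"
      unfolding sum.distrib[symmetric] by (intro sum_mono) arith
    then show ?thesis
      using d1(2)[OF fam(1)] d2(2)[OF fam(1)] fam(2) by linarith
  qed
  then show "\<exists>\<delta>>0. \<forall>(m::nat) u v. interval_family {..<m} u v \<and> (\<Sum>i<m. v i - u i) < \<delta> \<longrightarrow>
        (\<Sum>i<m. \<bar>f (v i) - g (v i) - (f (u i) - g (u i))\<bar>) < \<epsilon>"
    using d1(1) d2(1) by (intro exI[of _ "min d1 d2"]) auto
qed

text \<open>
  A compact null set is covered by the cells of a fine grid that meet it; they lie in a prescribed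
  open neighbourhood and hence have small total length.
\<close>

lemma compact_null_cover:
  assumes K: "compact K" "emeasure lborel K = 0" and "\<delta> > 0"
  obtains I :: "int set" and u v where "interval_family I u v" "(\<Sum>i\<in>I. v i - u i) < \<delta>"
    "K \<subseteq> (\<Union>i\<in>I. {u i<..v i})" "disjoint_family_on (\<lambda>i. {u i<..v i}) I"
proof -
  have Kb: "K \<in> sets borel"
    using K(1) by (simp add: borel_compact)
  obtain U where U: "open U" "K \<subseteq> U" "emeasure lborel (U - K) < \<delta>"
    using outer_regular_lborel[OF Kb \<open>\<delta> > 0\<close>] by blast
  have "emeasure lborel U \<le> emeasure lborel K + emeasure lborel (U - K)"
    using U(1) Kb by (intro order_trans[OF emeasure_mono emeasure_subadditive]) auto
  then have lenU: "emeasure lborel U < \<delta>"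
    using K(2) U(3) by simp
  obtain r where r: "r > 0" "(\<Union>x\<in>K. ball x r) \<subseteq> U"
    using compact_subset_open_imp_ball_epsilon_subset[OF K(1) U(1,2)] by blast
  obtain N :: nat where N: "N > 0" "1 / N < r"
    using r(1) by (metis nat_approx_posE zero_less_Suc)
  \<comment> \<open>The cells are half-open on the left, so each point \<open>x\<close> lies in
    exactly one of them, the cell with index \<open>\<lceil>x * N\<rceil>\<close>. Those that meet
    \<open>K\<close> are therefore disjoint and, as \<open>K\<close> is bounded, finite in
    number.\<close>
  define u v where "u = (\<lambda>i::int. (i - 1) / N)" and "v = (\<lambda>i::int. i / N)"
  have vu: "v i - u i = 1 / N" "u i < v i" for i
    using N(1) by (auto simp: u_def v_def field_simps)
  define I where "I = {i. {u i<..v i} \<inter> K \<noteq> {}}"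
  have mem: "x \<in> {u i<..v i} \<longleftrightarrow> i = \<lceil>x * N\<rceil>" for x i
    using N(1) by (auto simp: u_def v_def field_simps ceiling_eq_iff) linarith+
  have IK: "I = (\<lambda>x. \<lceil>x * N\<rceil>) ` K"
    unfolding I_def using mem by (auto simp: image_iff)
  obtain b where b: "\<And>x. x \<in> K \<Longrightarrow> \<bar>x\<bar> \<le> b"
    using compact_imp_bounded[OF K(1)] by (auto simp: bounded_iff)
  have "I \<subseteq> {\<lceil>- b * N\<rceil>..\<lceil>b * N\<rceil>}"
    unfolding IK
  proof (clarsimp)
    fix x assume "x \<in> K"
    then have "- b \<le> x" "x \<le> b"
      using b[of x] by auto
    then have "- b * N \<le> x * N" "x * N \<le> b * N"
      by (intro mult_right_mono; simp)+
    then show "\<lceil>- (b * N)\<rceil> \<le> \<lceil>x * N\<rceil> \<and> \<lceil>x * N\<rceil> \<le> \<lceil>b * N\<rceil>"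
      by (simp add: ceiling_mono)
  qed
  then have "finite I"
    by (rule finite_subset) simp
  have disj: "disjoint_family_on (\<lambda>i. {u i<..v i}) I"
    unfolding disjoint_family_on_def by (auto simp del: greaterThanAtMost_iff Int_greaterThanAtMost simp: mem)
  \<comment> \<open>A cell has length \<open>1 / N < r\<close>, so it stays in the ball of radius
    \<open>r\<close> about any of its points in \<open>K\<close>.\<close>
  have sub: "{u i<..v i} \<subseteq> U" if i: "i \<in> I" for i
  proof -
    obtain x where x: "x \<in> {u i<..v i}" "x \<in> K"
      using i unfolding I_def by blast
    have "{u i<..v i} \<subseteq> ball x r"
      using x(1) vu(1)[of i] N(2) by (auto simp: dist_real_def)
    then show ?thesis
      using r(2) x(2) by blast
  qed
  have "ennreal (\<Sum>i\<in>I. v i - u i) = (\<Sum>i\<in>I. emeasure lborel {u i<..v i})"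
    using vu(2) by (simp add: sum_ennreal less_imp_le)
  also have "\<dots> = emeasure lborel (\<Union>i\<in>I. {u i<..v i})"
    by (intro sum_emeasure \<open>finite I\<close> disj) auto
  also have "\<dots> \<le> emeasure lborel U"
    using sub U(1) by (intro emeasure_mono) auto
  finally have "ennreal (\<Sum>i\<in>I. v i - u i) < \<delta>"
    using lenU by simp
  then have "(\<Sum>i\<in>I. v i - u i) < \<delta>"
    using \<open>\<delta> > 0\<close> by (simp add: ennreal_less_iff sum_nonneg vu(2) less_imp_le)
  moreover have "interval_family I u v"
    using \<open>finite I\<close> vu(2) disj unfolding interval_family_def disjoint_family_on_def
    by (fastforce simp: less_imp_le)
  moreover have "K \<subseteq> (\<Union>i\<in>I. {u i<..v i})"
    using mem IK by blast
  ultimately show ?thesis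
    using disj that by blast
qed

section \<open>The fundamental theorem of calculus for absolutely continuous functions\<close>

text \<open>The Stieltjes measure of \<open>F\<close> vanishes on compact Lebesgue null sets:
  finitely many intervals of small total length cover such a set, and \<open>F\<close> grows little
  over them. Inner regularity carries this to all null sets, and the Radon-Nikodym density is the
  required function.\<close>

lemma mono_ac_real_density:
  fixes F :: "real \<Rightarrow> real"
  assumes mono: "\<And>x y. x \<le> y \<Longrightarrow> F x \<le> F y" and ac: "ac_real F" and bdd: "\<And>x. \<bar>F x\<bar> \<le> B"
  obtains g where "integrable lborel g"
    and "\<And>a b. a \<le> b \<Longrightarrow> F b - F a = (LINT x:{a<..b}|lborel. g x)"
proof -
  define M where "M = interval_measure F"
  have cont: "continuous (at_right a) F" for a
    using ac_real_continuous[OF ac] by (rule continuous_at_imp_continuous_at_within)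
  have [simp]: "sets M = sets borel" "space M = UNIV"
    by (auto simp: M_def)
  have Ioc: "emeasure M {a<..b} = F b - F a" if "a \<le> b" for a b
    unfolding M_def using that mono cont by (rule emeasure_interval_measure_Ioc)
  have "emeasure M (\<Union>n::nat. {-real n<..real n}) = (SUP n. emeasure M {-real n<..real n})"
    by (intro SUP_emeasure_incseq[symmetric]) (auto simp: incseq_def)
  also have "(\<Union>n::nat. {-real n<..real n}) = UNIV"
  proof (intro equalityI subsetI UNIV_I)
    fix x :: real
    obtain n :: nat where "\<bar>x\<bar> < n" using reals_Archimedean2 by blast
    then show "x \<in> (\<Union>n::nat. {-real n<..real n})" by (intro UN_I[of n]) auto
  qed
  \<comment> \<open>Boundedness of \<open>F\<close> makes \<open>M\<close> finite, as inner
    regularity by compact sets demands; it also makes the density integrable.\<close>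
  also have "(SUP n::nat. emeasure M {-real n<..real n}) \<le> ennreal (2 * B)"
  proof (rule SUP_least)
    fix n :: nat
    show "emeasure M {-real n<..real n} \<le> ennreal (2 * B)"
      using bdd[of n] bdd[of "- n"] by (subst Ioc) (auto intro!: ennreal_leI)
  qed
  finally have "emeasure M UNIV \<le> ennreal (2 * B)" .
  then have fin: "emeasure M (space M) \<noteq> \<infinity>"
    by (auto simp: top_unique)
  have compact_null: "emeasure M K = 0" if K: "compact K" "emeasure lborel K = 0" for K
  proof -
    have *: "emeasure M K \<le> 0 + ennreal e" if "e > 0" for e
    proof -
      obtain \<delta> where \<delta>: "\<delta> > 0" "\<And>(I::int set) u v. interval_family I u v \<Longrightarrow> (\<Sum>i\<in>I. v i - u i) < \<delta> \<Longrightarrow>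
            (\<Sum>i\<in>I. \<bar>F (v i) - F (u i)\<bar>) < e"
        using ac_real_family[OF ac \<open>e > 0\<close>, where ?'i = int] by metis
      obtain I :: "int set" and u v where I: "interval_family I u v" "(\<Sum>i\<in>I. v i - u i) < \<delta>"
        "K \<subseteq> (\<Union>i\<in>I. {u i<..v i})" "disjoint_family_on (\<lambda>i. {u i<..v i}) I"
        using compact_null_cover[OF K \<delta>(1)] by blast
      have le: "u i \<le> v i" if "i \<in> I" for i
        using I(1) that by (auto simp: interval_family_def)
      have fin: "finite I"
        using I(1) by (auto simp: interval_family_def)
      have "emeasure M K \<le> emeasure M (\<Union>i\<in>I. {u i<..v i})"
        using I(3) fin by (intro emeasure_mono) (auto intro!: sets.finite_UN)
      also have "\<dots> = (\<Sum>i\<in>I. emeasure M {u i<..v i})"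
        by (intro sum_emeasure[symmetric] I(4) fin) auto
      also have "\<dots> = (\<Sum>i\<in>I. ennreal \<bar>F (v i) - F (u i)\<bar>)"
        using le mono by (intro sum.cong) (auto simp: Ioc)
      also have "\<dots> = ennreal (\<Sum>i\<in>I. \<bar>F (v i) - F (u i)\<bar>)"
        by (rule sum_ennreal) simp
      also have "\<dots> \<le> ennreal e"
        using \<delta>(2)[OF I(1,2)] by (intro ennreal_leI) simp
      finally show ?thesis by simp
    qed
    have "emeasure M K \<le> 0"
      by (rule ennreal_le_epsilon) (rule *)
    then show ?thesis by simp
  qed
  have "absolutely_continuous lborel M"
    unfolding absolutely_continuous_def
  proof
    fix N assume N: "N \<in> null_sets (lborel :: real measure)"
    then have Nb: "N \<in> sets borel" by auto
    have "emeasure M N = (SUP K \<in> {K. K \<subseteq> N \<and> compact K}. emeasure M K)"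
      by (rule inner_regular[OF _ fin Nb]) simp
    also have "\<dots> = (SUP K \<in> {K. K \<subseteq> N \<and> compact K}. 0)"
    proof (rule SUP_cong[OF refl])
      fix K assume "K \<in> {K. K \<subseteq> N \<and> compact K}"
      then have "emeasure lborel K \<le> emeasure lborel N" and "compact K"
        using N by (auto intro!: emeasure_mono)
      then show "emeasure M K = 0"
        using N compact_null[of K] by (simp add: null_setsD1)
    qed
    also have "\<dots> = 0" by (simp add: bot_ennreal[symmetric] del: bot_ennreal)
    finally show "N \<in> null_sets M"
      using Nb by auto
  qed
  then obtain g0 where g0 [measurable]: "g0 \<in> borel_measurable lborel" and dens: "density lborel g0 = M"
    using sigma_finite_measure.Radon_Nikodym[OF sigma_finite_lborel, of M] by auto
  have "(\<integral>\<^sup>+x. g0 x \<partial>lborel) = emeasure M UNIV"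
    unfolding dens[symmetric] by (subst emeasure_density) auto
  then have finite: "(\<integral>\<^sup>+x. g0 x \<partial>lborel) \<noteq> \<infinity>"
    using fin by simp
  then have AEfin: "AE x in lborel. g0 x \<noteq> \<infinity>"
    by (intro nn_integral_noteq_infinite) auto
  \<comment> \<open>The Radon-Nikodym density takes values in \<open>ennreal\<close>; its integral
    is finite, so passing to a real function changes it only on a null set.\<close>
  define g where "g = (\<lambda>x. enn2real (g0 x))"
  have [measurable]: "g \<in> borel_measurable borel"
    using g0 unfolding g_def by (simp add: measurable_lborel1)
  have AEg: "AE x in lborel. ennreal (g x) = g0 x"
    using AEfin by eventually_elim (simp add: g_def less_top)
  have g_nn: "g x \<ge> 0" for x by (simp add: g_def)
  have "(\<integral>\<^sup>+x. ennreal (g x) \<partial>lborel) = (\<integral>\<^sup>+x. g0 x \<partial>lborel)"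
    by (rule nn_integral_cong_AE[OF AEg])
  then have int: "integrable lborel g"
    using finite by (intro integrableI_nonneg) (auto simp: g_nn less_top)
  have "F b - F a = (LINT x:{a<..b}|lborel. g x)" if "a \<le> b" for a b
  proof -
    have "(LINT x:{a<..b}|lborel. g x) = enn2real (\<integral>\<^sup>+x. ennreal (indicator {a<..b} x *\<^sub>R g x) \<partial>lborel)"
      unfolding set_lebesgue_integral_def by (intro integral_eq_nn_integral) (auto simp: g_nn)
    also have "(\<integral>\<^sup>+x. ennreal (indicator {a<..b} x *\<^sub>R g x) \<partial>lborel) = (\<integral>\<^sup>+x. g0 x * indicator {a<..b} x \<partial>lborel)"
      by (intro nn_integral_cong_AE eventually_mono[OF AEg]) (auto simp: indicator_def)
    also have "\<dots> = emeasure M {a<..b}"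
      unfolding dens[symmetric] by (subst emeasure_density) auto
    finally show ?thesis
      using that mono[OF that] by (simp add: Ioc)
  qed
  with int show thesis by (rule that)
qed

text \<open>
  Henstock's lemma bounds the total length of any disjoint intervals on which the difference quotient
  of the indefinite integral is far from the integrand; by Vitali's theorem such intervals cover the
  exceptional set.
\<close>

lemma indefinite_integral_has_derivative_ae:
  fixes f :: "real \<Rightarrow> real"
  assumes f: "f integrable_on {a..b}"
  shows "negligible {x \<in> {a<..<b}. \<not> ((\<lambda>y. integral {a..y} f) has_real_derivative f x) (at x)}"
proof -
  define F where "F = (\<lambda>y. integral {a..y} f)"
  \<comment> \<open>The difference quotient between \<open>x\<close> and \<open>y\<close>, on either
    side of \<open>x\<close>, misses \<open>f x\<close> by more than \<open>1 / (k + 1)\<close>.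
    Non-differentiability with derivative \<open>f x\<close> means that for some \<open>k\<close>
    such \<open>y\<close> occur arbitrarily close to \<open>x\<close>, which is membership in
    \<open>E k\<close>.\<close>
  define bad where "bad = (\<lambda>(k::nat) x y. y \<in> {a<..<b} \<and> \<bar>y - x\<bar> / (k + 1) < \<bar>F y - F x - f x * (y - x)\<bar>)"
  define E where "E = (\<lambda>k::nat. {x \<in> {a<..<b}. \<forall>d>0. \<exists>y. \<bar>y - x\<bar> < d \<and> bad k x y})"
  have Fdiff: "integral {min x y..max x y} f = (if x \<le> y then F y - F x else F x - F y)"
    if "x \<in> {a<..<b}" "y \<in> {a<..<b}" for x y
  proof -
    have *: "F z + integral {z..w} f = F w" if "a < z" "z \<le> w" "w < b" for z w
      unfolding F_def using that
      by (intro Henstock_Kurzweil_Integration.integral_combine integrable_on_subinterval[OF f]) auto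
    show ?thesis
      using *[of x y] *[of y x] that by (auto simp: min_def max_def)
  qed
  have f': "f integrable_on cbox a b"
    using f by simp
  have "negligible (E k)" for k
    unfolding negligible_outer_le
  proof (intro allI impI)
    fix e :: real assume "e > 0"
    \<comment> \<open>Passing from Henstock's error to lengths costs a factor \<open>k + 1\<close>,
      which this choice absorbs.\<close>
    then have "e / (k + 1) > 0" by simp
    then obtain \<gamma> where \<gamma>: "gauge \<gamma>"
      and hen: "\<And>p. \<lbrakk>p tagged_partial_division_of (cbox a b); \<gamma> fine p\<rbrakk> \<Longrightarrow>
             sum (\<lambda>(x,k). norm(measure lborel k *\<^sub>R f x - integral k f)) p < e / (k + 1)"
      by (rule Henstock_lemma[OF f']) blast
    \<comment> \<open>The interval between \<open>x\<close> and \<open>y\<close> lies in the gauge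
      set at \<open>x\<close>, so tagging it with its endpoint \<open>x\<close> is
      \<open>\<gamma>\<close>-fine. \<open>J\<close> writes the same interval as a closed ball about
      its midpoint, the form required by the Vitali covering theorem.\<close>
    define K where "K = {(x, y). x \<in> E k \<and> y \<noteq> x \<and> bad k x y \<and> {min x y..max x y} \<subseteq> \<gamma> x}"
    define J where "J = (\<lambda>(x::real, y). cball ((x + y) / 2) (\<bar>y - x\<bar> / 2))"
    have J: "J (x, y) = {min x y..max x y}" for x y
      by (auto simp: J_def cball_eq_atLeastAtMost field_simps min_def max_def abs_if)
    obtain C where C: "countable C" "C \<subseteq> K" "pairwise (\<lambda>p q. disjnt (J p) (J q)) C"
      "negligible (E k - (\<Union>p\<in>C. J p))"
    proof (rule Vitali_covering_theorem_cballs[of K "\<lambda>(x, y). \<bar>y - x\<bar> / 2" "E k" "\<lambda>(x, y). (x + y) / 2"])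
      show "0 < (case p of (x, y) \<Rightarrow> \<bar>y - x\<bar> / 2)" if "p \<in> K" for p
        using that by (auto simp: K_def)
      fix x d :: real assume x: "x \<in> E k" and "0 < d"
      obtain r where r: "r > 0" "ball x r \<subseteq> \<gamma> x"
      proof -
        have "open (\<gamma> x)" "x \<in> \<gamma> x" using \<gamma> by (auto simp: gauge_def)
        then show ?thesis using that by (rule openE)
      qed
      obtain y where y: "\<bar>y - x\<bar> < min r d" "bad k x y"
      proof -
        have "min r d > 0" using r(1) \<open>0 < d\<close> by simp
        then have "\<exists>y. \<bar>y - x\<bar> < min r d \<and> bad k x y"
          using x unfolding E_def by blast
        then show ?thesis using that by blast
      qed
      have "{min x y..max x y} \<subseteq> ball x r"
        using y(1) by (auto simp: dist_real_def)
      moreover have "y \<noteq> x"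
        using y(2) by (auto simp: bad_def)
      ultimately have "(x, y) \<in> K"
        using x y(2) r(2) by (auto simp: K_def)
      moreover have "x \<in> J (x, y)"
        by (simp add: J)
      ultimately show "\<exists>p. p \<in> K \<and> x \<in> cball (case p of (x, y) \<Rightarrow> (x + y) / 2) (case p of (x, y) \<Rightarrow> \<bar>y - x\<bar> / 2) \<and>
          (case p of (x, y) \<Rightarrow> \<bar>y - x\<bar> / 2) < d"
        using y(1) by (intro exI[of _ "(x, y)"]) (auto simp: J_def)
    next
      fix C assume "countable C" "C \<subseteq> K"
        "pairwise (\<lambda>i j. disjnt (cball (case i of (x, y) \<Rightarrow> (x + y) / 2) (case i of (x, y) \<Rightarrow> \<bar>y - x\<bar> / 2))
             (cball (case j of (x, y) \<Rightarrow> (x + y) / 2) (case j of (x, y) \<Rightarrow> \<bar>y - x\<bar> / 2))) C"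
        "negligible (E k - (\<Union>i\<in>C. cball (case i of (x, y) \<Rightarrow> (x + y) / 2) (case i of (x, y) \<Rightarrow> \<bar>y - x\<bar> / 2)))"
      then show thesis
        by (intro that[of C]) (auto simp: J_def split_def)
    qed
    have Kab: "x \<in> {a<..<b}" "y \<in> {a<..<b}" "y \<noteq> x" "bad k x y" "J (x, y) \<subseteq> \<gamma> x" if "(x, y) \<in> K" for x y
      using that by (auto simp: K_def E_def bad_def J)
    have fin_bound: "measure lebesgue (\<Union>p\<in>D. J p) \<le> e" if D: "D \<subseteq> C" "finite D" for D
    proof -
      define p where "p = (\<lambda>q. (fst q, J q)) ` D"
      have DK: "q \<in> K" if "q \<in> D" for q using that D(1) C(2) by blast
      have disj: "disjnt (J q) (J q')" if "q \<in> D" "q' \<in> D" "q \<noteq> q'" for q q'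
        using that D(1) C(3) by (auto simp: pairwise_def)
      have fstJ: "fst q \<in> J q" for q
        by (cases q) (simp add: J)
      have "inj_on (\<lambda>q. (fst q, J q)) D"
        using disj fstJ by (force simp: inj_on_def disjnt_iff)
      have "p tagged_partial_division_of (cbox a b)"
        unfolding tagged_partial_division_of_def
      proof (intro conjI allI impI)
        show "finite p" using D(2) by (simp add: p_def)
      next
        fix x K assume "(x, K) \<in> p"
        then obtain y where y: "(x, y) \<in> D" "K = J (x, y)" by (auto simp: p_def)
        show "x \<in> K" "K \<subseteq> cbox a b" "\<exists>a b. K = cbox a b"
          using Kab[OF DK[OF y(1)]] y(2) by (auto simp: J)
      next
        fix x1 K1 x2 K2 assume *: "(x1, K1) \<in> p \<and> (x2, K2) \<in> p \<and> (x1, K1) \<noteq> (x2, K2)"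
        then obtain q1 q2 where "q1 \<in> D" "q2 \<in> D" "K1 = J q1" "K2 = J q2" "q1 \<noteq> q2"
          by (auto simp: p_def)
        then have "disjnt K1 K2" using disj by blast
        then show "interior K1 \<inter> interior K2 = {}"
          using interior_subset[of K1] interior_subset[of K2] by (auto simp: disjnt_def)
      qed
      moreover have "\<gamma> fine p"
        using Kab(5) DK by (fastforce simp: fine_def p_def)
      ultimately have "sum (\<lambda>(x,k). norm(measure lborel k *\<^sub>R f x - integral k f)) p < e / (k + 1)"
        by (rule hen)
      then have small: "(\<Sum>q\<in>D. norm (measure lborel (J q) *\<^sub>R f (fst q) - integral (J q) f)) < e / (k + 1)"
        unfolding p_def by (subst (asm) sum.reindex) (auto simp: \<open>inj_on _ D\<close> split_def comp_def)
      have "measure lebesgue (\<Union>q\<in>D. J q) = (\<Sum>q\<in>D. measure lebesgue (J q))"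
        using disj D(2) by (intro measure_finite_Union) (auto simp: J_def disjoint_family_on_def disjnt_def emeasure_cball split_def)
      also have "\<dots> \<le> (\<Sum>q\<in>D. (k + 1) * norm (measure lborel (J q) *\<^sub>R f (fst q) - integral (J q) f))"
      proof (rule sum_mono)
        fix q assume "q \<in> D"
        obtain x y where q: "q = (x, y)" by fastforce
        have xy: "x \<in> {a<..<b}" "y \<in> {a<..<b}" "bad k x y"
          using Kab[of x y] DK[OF \<open>q \<in> D\<close>] q by auto
        have c: "measure lborel (J q) = \<bar>y - x\<bar>"
          by (auto simp: q J min_def max_def)
        \<comment> \<open>Badness of the pair says exactly that the Henstock error on this interval
          exceeds its length divided by \<open>k + 1\<close>.\<close>
        have "\<bar>y - x\<bar> / (k + 1) < norm (measure lborel (J q) *\<^sub>R f (fst q) - integral (J q) f)"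
          using xy(3) Fdiff[OF xy(1,2)] unfolding c by (auto simp: q J bad_def abs_if algebra_simps split: if_splits)
        then have "\<bar>y - x\<bar> \<le> (k + 1) * norm (measure lborel (J q) *\<^sub>R f (fst q) - integral (J q) f)"
          by (simp add: field_simps)
        then show "measure lebesgue (J q) \<le> (k + 1) * norm (measure lborel (J q) *\<^sub>R f (fst q) - integral (J q) f)"
          using c by (simp add: q J)
      qed
      also have "\<dots> = (k + 1) * (\<Sum>q\<in>D. norm (measure lborel (J q) *\<^sub>R f (fst q) - integral (J q) f))"
        by (rule sum_distrib_left[symmetric])
      also have "\<dots> \<le> e"
        using small by (simp add: field_simps)
      finally show ?thesis .
    qed
    have cntC: "countable (J ` C)"
      using C(1) by simp
    have measJ: "D \<in> lmeasurable" if "D \<in> J ` C" for D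
      using that by (auto simp: J_def)
    have boundJ: "measure lebesgue (\<Union>\<E>) \<le> e" if E: "\<E> \<subseteq> J ` C" "finite \<E>" for \<E>
    proof -
      obtain D where "D \<subseteq> C" "finite D" "\<E> = J ` D"
        using finite_subset_image[OF E(2,1)] by blast
      then show ?thesis using fin_bound by simp
    qed
    \<comment> \<open>The bound \<open>e\<close> is uniform over finite subfamilies, hence passes to
      the countable union.\<close>
    have Cm: "\<Union>(J ` C) \<in> lmeasurable" "measure lebesgue (\<Union>(J ` C)) \<le> e"
      by (rule fmeasurable_Union_bound[OF cntC measJ boundJ], assumption+)
        (rule measure_Union_bound[OF cntC measJ boundJ], assumption+)
    let ?T = "\<Union>(J ` C) \<union> (E k - \<Union>(J ` C))"
    have R: "E k - \<Union>(J ` C) \<in> lmeasurable" "measure lebesgue (E k - \<Union>(J ` C)) = 0"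
      using negligible_imp_measurable[OF C(4)] negligible_imp_measure0[OF C(4)] by auto
    have "?T \<in> lmeasurable"
      using Cm(1) R(1) by (rule fmeasurable.Un)
    moreover have "measure lebesgue ?T \<le> e"
      using measure_Un_le[of "\<Union>(J ` C)" lebesgue "E k - \<Union>(J ` C)"] Cm R by (simp add: fmeasurableD)
    ultimately show "\<exists>T. E k \<subseteq> T \<and> T \<in> lmeasurable \<and> measure lebesgue T \<le> e"
      by (intro exI[of _ ?T]) auto
  qed
  then have "negligible (\<Union>k. E k)"
    by (rule negligible_Union_nat)
  moreover have "{x \<in> {a<..<b}. \<not> (F has_real_derivative f x) (at x)} \<subseteq> (\<Union>k. E k)"
  proof
    fix x assume "x \<in> {x \<in> {a<..<b}. \<not> (F has_real_derivative f x) (at x)}"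
    then have x: "x \<in> {a<..<b}" and "\<not> (F has_derivative (*) (f x)) (at x)"
      by (auto simp: has_field_derivative_def)
    then obtain e where "e > 0"
      and e: "\<And>d. d > 0 \<Longrightarrow> \<exists>y. \<bar>y - x\<bar> < d \<and> e * \<bar>y - x\<bar> < \<bar>F y - F x - f x * (y - x)\<bar>"
      unfolding has_derivative_at_alt by (auto simp: not_le bounded_linear_mult_right)
    obtain k :: nat where k: "1 / (k + 1) < e"
      using nat_approx_posE[OF \<open>e > 0\<close>] by (auto simp: add.commute)
    have "\<exists>y. \<bar>y - x\<bar> < d \<and> bad k x y" if "d > 0" for d
    proof -
      \<comment> \<open>\<open>bad\<close> asks for \<open>y\<close> inside the open interval from
        \<open>a\<close> to \<open>b\<close>, so the neighbourhood of \<open>x\<close> is shrunk to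
        fit into it.\<close>
      define d' where "d' = min d (min (x - a) (b - x))"
      have "d' > 0" using that x by (simp add: d'_def)
      then obtain y where y: "\<bar>y - x\<bar> < d'" "e * \<bar>y - x\<bar> < \<bar>F y - F x - f x * (y - x)\<bar>"
        using e by blast
      have "\<bar>y - x\<bar> * (1 / (k + 1)) \<le> \<bar>y - x\<bar> * e"
        using k by (intro mult_left_mono) auto
      then show ?thesis
        using y by (intro exI[of _ y]) (auto simp: bad_def d'_def mult.commute add.commute)
    qed
    then show "x \<in> (\<Union>k. E k)"
      using x by (auto simp: E_def)
  qed
  ultimately show ?thesis
    unfolding F_def by (rule negligible_subset)
qed

text \<open>After clamping, \<open>f\<close> is a difference of two bounded nondecreasing absolutely
  continuous functions, and \<open>g\<close> is the difference of their densities. Differentiating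
  the indefinite integral of \<open>g\<close> almost everywhere then identifies \<open>g\<close>
  with the derivative of \<open>f\<close>.\<close>

lemma absolutely_continuous_ftc:
  assumes "absolutely_continuous_on_interval 0 1 f"
  obtains g where "integrable lborel g"
    and "\<And>x. x \<in> {0..1} \<Longrightarrow> f x - f 0 = (LINT t:{0..x}|lborel. g t)"
    and "AE x in lborel. x \<in> {0<..<1} \<longrightarrow> (f has_real_derivative g x) (at x)"
proof -
  define h where "h = (\<lambda>x. f (max 0 (min 1 x)))"
  have h: "ac_real h"
    unfolding h_def by (rule ac_real_clamp[OF assms])
  obtain B where B: "\<And>(m::nat) u v. interval_family {..<m} u v \<Longrightarrow> (\<Sum>i<m. \<bar>h (v i) - h (u i)\<bar>) \<le> B"
    by (rule ac_real_bounded_variation[OF h]) (auto simp: h_def)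
  have h_bdd: "\<bar>h x\<bar> \<le> B + \<bar>h 0\<bar>" for x
  proof -
    have "interval_family {..<1::nat} (\<lambda>_. min 0 x) (\<lambda>_. max 0 x)"
      by (auto simp: interval_family_def disjoint_family_on_def)
    from B[OF this] show ?thesis
      by (auto simp: min_def max_def split: if_splits)
  qed
  let ?P = "pos_variation h" and ?Q = "\<lambda>x. pos_variation h x - h x"
  have P_bdd: "\<bar>?P x\<bar> \<le> B" for x
    using pos_variation_le[where f = h and x = x, OF B] pos_variation_nonneg[where f = h and x = x, OF B]
    by simp
  have P_ac: "ac_real ?P"
    by (rule ac_real_pos_variation[where f = h, OF B h])
  obtain p where p: "integrable lborel p" "\<And>a b. a \<le> b \<Longrightarrow> ?P b - ?P a = (LINT x:{a<..b}|lborel. p x)"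
    using mono_ac_real_density[of ?P B, OF pos_variation_mono[where f = h, OF B] P_ac P_bdd] by metis
  obtain q where q: "integrable lborel q" "\<And>a b. a \<le> b \<Longrightarrow> ?Q b - ?Q a = (LINT x:{a<..b}|lborel. q x)"
  proof (rule mono_ac_real_density[of ?Q "2 * B + \<bar>h 0\<bar>"])
    show "?Q x \<le> ?Q y" if "x \<le> y" for x y
      using pos_variation_increment_ge[where f = h, OF B that] by simp
    show "ac_real ?Q"
      by (rule ac_real_diff[OF P_ac h])
    show "\<bar>?Q x\<bar> \<le> 2 * B + \<bar>h 0\<bar>" for x
      using P_bdd[of x] h_bdd[of x] by linarith
    fix g assume "integrable lborel g" "\<And>a b. a \<le> b \<Longrightarrow> ?Q b - ?Q a = (LINT x:{a<..b}|lborel. g x)"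
    then show thesis by (rule that)
  qed
  define g where "g = (\<lambda>x. p x - q x)"
  have g: "integrable lborel g"
    unfolding g_def using p(1) q(1) by simp
  have set_int: "set_integrable lborel A k" if "integrable lborel k" "A \<in> sets borel" for k :: "real \<Rightarrow> real" and A
    using that integrable_mult_indicator[of A lborel k] by (simp add: set_integrable_def)
  have int: "f x - f 0 = (LINT t:{0..x}|lborel. g t)" if x: "x \<in> {0..1}" for x
  proof -
    have "f x - f 0 = (?P x - ?P 0) - (?Q x - ?Q 0)"
      using x by (simp add: h_def)
    also have "\<dots> = (LINT t:{0<..x}|lborel. g t)"
      using x p q set_int[OF p(1)] set_int[OF q(1)] by (simp add: g_def set_integral_diff)
    also have "\<dots> = (LINT t:{0..x}|lborel. g t)"
      using AE_lborel_singleton[of "0::real"] unfolding set_lebesgue_integral_def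
      by (intro integral_cong_AE) (use g in \<open>auto intro!: borel_measurable_scaleR elim!: eventually_mono simp: indicator_def\<close>)
    finally show ?thesis .
  qed
  have g_on: "g integrable_on {0..1}"
    using set_borel_integral_eq_integral(1)[OF set_int[OF g]] by simp
  let ?N = "{x \<in> {0<..<1}. \<not> ((\<lambda>y. integral {0..y} g) has_real_derivative g x) (at x)}"
  have "negligible ?N"
    by (rule indefinite_integral_has_derivative_ae[OF g_on])
  then have "AE x in lebesgue. x \<notin> ?N"
    unfolding negligible_iff_null_sets by (rule AE_not_in)
  then have "AE x in lborel. x \<notin> ?N"
    by (simp add: AE_completion_iff)
  moreover have "(f has_real_derivative g x) (at x)" if x: "x \<in> {0<..<1}" "x \<notin> ?N" for x
  proof -
    have "((\<lambda>y. integral {0..y} g + f 0) has_real_derivative g x) (at x)"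
      using that by (auto intro!: derivative_eq_intros)
    \<comment> \<open>On the open unit interval \<open>f\<close> coincides with the indefinite
      integral of \<open>g\<close> plus \<open>f 0\<close>, and derivatives are local.\<close>
    then show ?thesis
    proof (rule has_field_derivative_transform_within_open[of _ _ _ "{0<..<1}"])
      fix y :: real assume "y \<in> {0<..<1}"
      then show "integral {0..y} g + f 0 = f y"
        using int[of y] set_borel_integral_eq_integral(2)[OF set_int[OF g], of "{0..y}"] by simp
    qed (use x in auto)
  qed
  ultimately have "AE x in lborel. x \<in> {0<..<1} \<longrightarrow> (f has_real_derivative g x) (at x)"
    by (auto elim!: eventually_mono)
  with g int show thesis by (rule that)
qed

section \<open>The Cameron-Martin space\<close>

lemma AE_lebesgue_on_01_iff:
  "(AE t in lebesgue_on {0..1}. P t) \<longleftrightarrow> (AE t in lebesgue. t \<in> {0..1::real} \<longrightarrow> P t)"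
  by (subst AE_restrict_space_iff) auto

lemma AE_lebesgue_neq: "AE t in lebesgue. t \<noteq> (a::real)"
  by (rule AE_completion[OF AE_lborel_singleton])

lemma integral_lebesgue_on_initial:
  assumes "x \<in> {0..1::real}"
  shows "(LINT t|lebesgue_on {0..x}. f t) = (LINT t|lebesgue_on {0..1}. indicator {0..x} t * (f t :: real))"
  using assms
  by (subst (1 2) integral_restrict_space) (auto intro!: Bochner_Integration.integral_cong simp: indicator_def)

context
  fixes h :: c0
  assumes ac: "absolutely_continuous_on_interval 0 1 (c0_apply h)"
begin

lemma ac_path_density:
  obtains g where "integrable lborel g"
    and "\<And>x. x \<in> {0..1} \<Longrightarrow> h x = (LINT t:{0..x}|lborel. g t)"
    and "AE t in lebesgue_on {0..1}. (c0_apply h has_real_derivative g t) (at t)"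
proof -
  obtain g where g: "integrable lborel g"
    and int: "\<And>x. x \<in> {0..1} \<Longrightarrow> h x - h 0 = (LINT t:{0..x}|lborel. g t)"
    and deriv: "AE x in lborel. x \<in> {0<..<1} \<longrightarrow> (c0_apply h has_real_derivative g x) (at x)"
    using ac by (rule absolutely_continuous_ftc) blast
  have "AE t in lebesgue_on {0..1}. (c0_apply h has_real_derivative g t) (at t)"
    unfolding AE_lebesgue_on_01_iff
    using AE_completion[OF deriv] AE_lebesgue_neq[of 0] AE_lebesgue_neq[of 1]
    by eventually_elim auto
  then show thesis
    using g int by (intro that) auto
qed

lemma ac_path_deriv_AE: "AE t in lebesgue_on {0..1}. (c0_apply h has_real_derivative c0_deriv h t) (at t)"
proof -
  obtain g where "AE t in lebesgue_on {0..1}. (c0_apply h has_real_derivative g t) (at t)"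
    by (rule ac_path_density)
  then show ?thesis
    by eventually_elim (simp add: c0_deriv_def DERIV_imp_deriv)
qed

text \<open>All three facts are transported from the Borel density \<open>g\<close>, with which
  \<open>c0_deriv h\<close> agrees almost everywhere. Measurability survives the arbitrary values of
  \<open>deriv\<close> on the exceptional null set because Lebesgue measure is complete.\<close>

lemma ac_path_deriv:
  shows c0_deriv_measurable: "c0_deriv h \<in> borel_measurable (lebesgue_on {0..1})"
    and c0_deriv_integrable: "integrable (lebesgue_on {0..1}) (c0_deriv h)"
    and c0_deriv_ftc: "x \<in> {0..1} \<Longrightarrow> (LINT t|lebesgue_on {0..x}. c0_deriv h t) = h x"
proof -
  obtain g where g: "integrable lborel g"
    and int: "\<And>x. x \<in> {0..1} \<Longrightarrow> h x = (LINT t:{0..x}|lborel. g t)"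
    and deriv: "AE t in lebesgue_on {0..1}. (c0_apply h has_real_derivative g t) (at t)"
    using ac_path_density by blast
  have eq: "AE t in lebesgue_on {0..1}. g t = c0_deriv h t"
    using deriv by eventually_elim (simp add: c0_deriv_def DERIV_imp_deriv)
  have gm [measurable]: "g \<in> borel_measurable borel"
    using g by (auto dest: borel_measurable_integrable)
  have gl: "g \<in> borel_measurable (lebesgue_on {0..1})"
    by (intro measurable_restrict_space1 measurable_completion) simp
  \<comment> \<open>Extension by zero moves the question to \<open>lebesgue\<close>, where almost
    everywhere equality preserves measurability.\<close>
  then have "(\<lambda>t. if t \<in> {0..1} then g t else 0) \<in> borel_measurable lebesgue"
    by (intro borel_measurable_if_I) auto
  moreover have "AE t in lebesgue. (if t \<in> {0..1} then g t else 0) = (if t \<in> {0..1} then c0_deriv h t else 0)"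
    using eq unfolding AE_lebesgue_on_01_iff by eventually_elim auto
  ultimately have "(\<lambda>t. if t \<in> {0..1} then c0_deriv h t else 0) \<in> borel_measurable lebesgue"
    by (rule borel_measurable_AE)
  then show meas: "c0_deriv h \<in> borel_measurable (lebesgue_on {0..1})"
    by (rule borel_measurable_if_D)
  have gi: "integrable (lebesgue_on {0..1}) g"
    using integrable_mult_indicator[OF _ g, of "{0..1}"]
    by (subst integrable_restrict_space) (auto simp: integrable_completion)
  show integ: "integrable (lebesgue_on {0..1}) (c0_deriv h)"
    by (rule integrable_cong_AE_imp[OF gi meas]) (use eq in \<open>auto elim!: eventually_mono\<close>)
  assume x: "x \<in> {0..1}"
  have [measurable]: "indicator {0..x} \<in> borel_measurable (lebesgue_on {0..1})"
    by (intro measurable_restrict_space1 measurable_completion) measurable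
  have "(LINT t|lebesgue_on {0..x}. c0_deriv h t) = (LINT t|lebesgue_on {0..1}. indicator {0..x} t * c0_deriv h t)"
    by (rule integral_lebesgue_on_initial[OF x])
  also have "\<dots> = (LINT t|lebesgue_on {0..1}. indicator {0..x} t * g t)"
    using meas gl eq by (intro integral_cong_AE) (auto elim!: eventually_mono)
  also have "\<dots> = (LINT t|lebesgue_on {0..x}. g t)"
    by (rule integral_lebesgue_on_initial[OF x, symmetric])
  also have "\<dots> = (LINT t:{0..x}|lebesgue. g t)"
    unfolding set_lebesgue_integral_def by (subst integral_restrict_space) auto
  also have "\<dots> = (LINT t:{0..x}|lborel. g t)"
    unfolding set_lebesgue_integral_def by (rule integral_completion) measurable
  finally show "(LINT t|lebesgue_on {0..x}. c0_deriv h t) = h x"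
    using int[OF x] by simp
qed

end

lemma cameron_martin_ac: "h \<in> cameron_martin \<Longrightarrow> absolutely_continuous_on_interval 0 1 (c0_apply h)"
  by (simp add: cameron_martin_def)

lemmas cm_deriv_measurable = c0_deriv_measurable[OF cameron_martin_ac]
lemmas cm_deriv_integrable = c0_deriv_integrable[OF cameron_martin_ac]
lemmas cm_ftc = c0_deriv_ftc[OF cameron_martin_ac]

lemma cm_deriv_mult_integrable:
  assumes "h \<in> cameron_martin" "k \<in> cameron_martin"
  shows "integrable (lebesgue_on {0..1}) (\<lambda>t. c0_deriv h t * c0_deriv k t)"
proof (rule Bochner_Integration.integrable_bound)
  show "integrable (lebesgue_on {0..1}) (\<lambda>t. (c0_deriv h t)\<^sup>2 + (c0_deriv k t)\<^sup>2)"
    using assms by (auto simp: cameron_martin_def)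
  have "\<bar>x * y\<bar> \<le> \<bar>x\<^sup>2 + y\<^sup>2\<bar>" for x y :: real
  proof -
    have "\<bar>x * y\<bar> \<le> x\<^sup>2 + y\<^sup>2"
      using sum_squares_bound[of "\<bar>x\<bar>" "\<bar>y\<bar>"] abs_ge_zero[of "x * y"]
      unfolding abs_mult power2_abs by linarith
    then show ?thesis by linarith
  qed
  then show "AE t in lebesgue_on {0..1}. norm (c0_deriv h t * c0_deriv k t) \<le>
      norm ((c0_deriv h t)\<^sup>2 + (c0_deriv k t)\<^sup>2)"
    by simp
qed (intro borel_measurable_times cm_deriv_measurable assms)

section \<open>Linear structure and inner product\<close>

lemma absolutely_continuous_on_interval_lincomb:
  assumes "absolutely_continuous_on_interval a b f" "absolutely_continuous_on_interval a b g"
  shows "absolutely_continuous_on_interval a b (\<lambda>x. p * f x + q * g x)"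
  unfolding absolutely_continuous_on_interval_def
proof (intro allI impI)
  fix \<epsilon> :: real assume "\<epsilon> > 0"
  \<comment> \<open>The summand 1 keeps \<open>M\<close> positive when both coefficients vanish and
    gives a strict inequality at the end.\<close>
  define M where "M = \<bar>p\<bar> + \<bar>q\<bar> + 1"
  have M: "M > 0" "\<bar>p\<bar> + \<bar>q\<bar> < M" by (auto simp: M_def)
  have "\<epsilon> / M > 0" using \<open>\<epsilon> > 0\<close> M by simp
  define small where "small = (\<lambda>\<delta> (m::nat) u v.
      (\<forall>i<m. a \<le> u i \<and> u i \<le> v i \<and> v i \<le> b) \<and>
      disjoint_family_on (\<lambda>i. {u i<..<v i}) {..<m} \<and> (\<Sum>i<m. v i - u i) < (\<delta>::real))"
  obtain d1 where d1: "d1 > 0" "\<And>m u v. small d1 m u v \<Longrightarrow> (\<Sum>i<m. \<bar>f (v i) - f (u i)\<bar>) < \<epsilon> / M"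
    using assms(1) \<open>\<epsilon> / M > 0\<close> unfolding absolutely_continuous_on_interval_def small_def by meson
  obtain d2 where d2: "d2 > 0" "\<And>m u v. small d2 m u v \<Longrightarrow> (\<Sum>i<m. \<bar>g (v i) - g (u i)\<bar>) < \<epsilon> / M"
    using assms(2) \<open>\<epsilon> / M > 0\<close> unfolding absolutely_continuous_on_interval_def small_def by meson
  have pos: "min d1 d2 > 0"
    using d1(1) d2(1) by simp
  have "(\<Sum>i<m. \<bar>p * f (v i) + q * g (v i) - (p * f (u i) + q * g (u i))\<bar>) < \<epsilon>"
    if s: "small (min d1 d2) m u v" for m u v
  proof -
    have "(\<Sum>i<m. \<bar>p * f (v i) + q * g (v i) - (p * f (u i) + q * g (u i))\<bar>) \<le>
        (\<Sum>i<m. \<bar>p\<bar> * \<bar>f (v i) - f (u i)\<bar> + \<bar>q\<bar> * \<bar>g (v i) - g (u i)\<bar>)"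
    proof (rule sum_mono)
      fix i
      have "p * f (v i) + q * g (v i) - (p * f (u i) + q * g (u i)) =
          p * (f (v i) - f (u i)) + q * (g (v i) - g (u i))"
        by (simp add: algebra_simps)
      then show "\<bar>p * f (v i) + q * g (v i) - (p * f (u i) + q * g (u i))\<bar> \<le>
          \<bar>p\<bar> * \<bar>f (v i) - f (u i)\<bar> + \<bar>q\<bar> * \<bar>g (v i) - g (u i)\<bar>"
        by (metis abs_mult abs_triangle_ineq)
    qed
    also have "\<dots> = \<bar>p\<bar> * (\<Sum>i<m. \<bar>f (v i) - f (u i)\<bar>) + \<bar>q\<bar> * (\<Sum>i<m. \<bar>g (v i) - g (u i)\<bar>)"
      by (simp add: sum.distrib sum_distrib_left)
    also have "\<dots> \<le> \<bar>p\<bar> * (\<epsilon> / M) + \<bar>q\<bar> * (\<epsilon> / M)"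
      using d1(2)[of m u v] d2(2)[of m u v] s
      by (intro add_mono mult_left_mono) (auto simp: small_def intro: less_imp_le)
    also have "\<dots> = (\<bar>p\<bar> + \<bar>q\<bar>) / M * \<epsilon>"
      by (simp add: field_simps add_divide_distrib)
    also have "\<dots> < 1 * \<epsilon>"
      using \<open>\<epsilon> > 0\<close> M by (intro mult_strict_right_mono) simp_all
    also have "\<dots> = \<epsilon>" by simp
    finally show ?thesis .
  qed
  then show "\<exists>\<delta>>0. \<forall>(m::nat) u v. (\<forall>i<m. a \<le> u i \<and> u i \<le> v i \<and> v i \<le> b) \<and>
      disjoint_family_on (\<lambda>i. {u i<..<v i}) {..<m} \<and> (\<Sum>i<m. v i - u i) < \<delta> \<longrightarrow>
      (\<Sum>i<m. \<bar>p * f (v i) + q * g (v i) - (p * f (u i) + q * g (u i))\<bar>) < \<epsilon>"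
    using pos unfolding small_def by blast
qed

text \<open>Only almost everywhere: where a path is not differentiable, \<open>deriv\<close> takes
  an arbitrary value and need not be linear.\<close>

lemma c0_deriv_lincomb_AE:
  assumes "h \<in> cameron_martin" "k \<in> cameron_martin"
  shows "AE t in lebesgue_on {0..1}.
    c0_deriv (a *\<^sub>R h + b *\<^sub>R k) t = a * c0_deriv h t + b * c0_deriv k t"
  using ac_path_deriv_AE[OF cameron_martin_ac[OF assms(1)]] ac_path_deriv_AE[OF cameron_martin_ac[OF assms(2)]]
proof eventually_elim
  case (elim t)
  have "((\<lambda>x. a * h x + b * k x) has_real_derivative a * c0_deriv h t + b * c0_deriv k t) (at t)"
    using elim by (auto intro!: derivative_eq_intros)
  moreover have "c0_apply (a *\<^sub>R h + b *\<^sub>R k) = (\<lambda>x. a * h x + b * k x)"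
    by auto
  ultimately show ?case
    unfolding c0_deriv_def by (metis DERIV_imp_deriv)
qed

lemma cameron_martin_lincomb:
  assumes "h \<in> cameron_martin" "k \<in> cameron_martin"
  shows "a *\<^sub>R h + b *\<^sub>R k \<in> cameron_martin"
proof -
  let ?l = "a *\<^sub>R h + b *\<^sub>R k"
  have "c0_apply ?l = (\<lambda>x. a * h x + b * k x)"
    by auto
  then have ac: "absolutely_continuous_on_interval 0 1 (c0_apply ?l)"
    using absolutely_continuous_on_interval_lincomb[of 0 1 h k a b] assms[THEN cameron_martin_ac] by simp
  have "integrable (lebesgue_on {0..1}) (\<lambda>t. a\<^sup>2 * (c0_deriv h t * c0_deriv h t) +
      2 * a * b * (c0_deriv h t * c0_deriv k t) + b\<^sup>2 * (c0_deriv k t * c0_deriv k t))"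
    using assms cm_deriv_mult_integrable by auto
  then have "integrable (lebesgue_on {0..1}) (\<lambda>t. (c0_deriv ?l t)\<^sup>2)"
  proof (rule integrable_cong_AE_imp)
    show "AE t in lebesgue_on {0..1}. a\<^sup>2 * (c0_deriv h t * c0_deriv h t) +
      2 * a * b * (c0_deriv h t * c0_deriv k t) + b\<^sup>2 * (c0_deriv k t * c0_deriv k t) = (c0_deriv ?l t)\<^sup>2"
      using c0_deriv_lincomb_AE[OF assms, of a b] by eventually_elim (simp add: power2_eq_square algebra_simps)
  qed (use c0_deriv_measurable[OF ac] in simp)
  with ac show ?thesis
    by (simp add: cameron_martin_def)
qed

lemma cameron_martin_scaleR: "h \<in> cameron_martin \<Longrightarrow> a *\<^sub>R h \<in> cameron_martin"
  using cameron_martin_lincomb[of h h a 0] by simp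

lemma cameron_martin_diff: "h \<in> cameron_martin \<Longrightarrow> k \<in> cameron_martin \<Longrightarrow> h - k \<in> cameron_martin"
  using cameron_martin_lincomb[of h k 1 "-1"] by simp

lemma cm_inner_commute: "cm_inner h k = cm_inner k h"
  by (simp add: cm_inner_def mult.commute)

lemma cm_inner_lincomb_left:
  assumes "h \<in> cameron_martin" "k \<in> cameron_martin" "l \<in> cameron_martin"
  shows "cm_inner (a *\<^sub>R h + b *\<^sub>R k) l = a * cm_inner h l + b * cm_inner k l"
proof -
  have "cm_inner (a *\<^sub>R h + b *\<^sub>R k) l =
      (LINT t|lebesgue_on {0..1}. a * (c0_deriv h t * c0_deriv l t) + b * (c0_deriv k t * c0_deriv l t))"
    unfolding cm_inner_def
  proof (rule integral_cong_AE)
    show "AE t in lebesgue_on {0..1}. c0_deriv (a *\<^sub>R h + b *\<^sub>R k) t * c0_deriv l t =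
        a * (c0_deriv h t * c0_deriv l t) + b * (c0_deriv k t * c0_deriv l t)"
      using c0_deriv_lincomb_AE[OF assms(1,2), of a b] by eventually_elim (simp add: algebra_simps)
  qed (use assms cm_deriv_measurable cameron_martin_lincomb in auto)
  then show ?thesis
    using assms cm_deriv_mult_integrable by (simp add: cm_inner_def)
qed

lemma cm_inner_lincomb_right:
  assumes "h \<in> cameron_martin" "k \<in> cameron_martin" "l \<in> cameron_martin"
  shows "cm_inner l (a *\<^sub>R h + b *\<^sub>R k) = a * cm_inner l h + b * cm_inner l k"
  using cm_inner_lincomb_left[OF assms] by (simp add: cm_inner_commute)

lemma cm_inner_self_nonneg: "cm_inner h h \<ge> 0"
  by (simp add: cm_inner_def)

lemma cm_norm_sq: "(cm_norm h)\<^sup>2 = cm_inner h h"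
  by (simp add: cm_norm_def cm_inner_self_nonneg)

text \<open>A vanishing norm only says that the derivative is zero almost everywhere; the
  fundamental theorem for absolutely continuous paths then forces the path itself to vanish. This
  definiteness gives the uniqueness of closest points and projections.\<close>

lemma cm_inner_self_eq_0:
  assumes "h \<in> cameron_martin" "cm_inner h h = 0"
  shows "h = 0"
proof (rule c0_eqI)
  fix x :: real assume x: "x \<in> {0..1}"
  have "AE t in lebesgue_on {0..1}. c0_deriv h t * c0_deriv h t = 0"
    using assms by (subst integral_nonneg_eq_0_iff_AE[symmetric]) (auto simp: cm_inner_def cm_deriv_mult_integrable)
  then have "(LINT t|lebesgue_on {0..1}. indicator {0..x} t * c0_deriv h t) = 0"
    by (intro integral_eq_zero_AE) (auto elim!: eventually_mono)
  then show "h x = (0::c0) x"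
    using cm_ftc[OF assms(1) x] integral_lebesgue_on_initial[OF x, of "c0_deriv h"] by simp
qed

section \<open>The reproducing kernel at \<open>T\<close> and the geometry of level
  subspaces\<close>

definition cm_kernel :: "real \<Rightarrow> c0" where
  "cm_kernel T = C0 (\<lambda>t. if t \<in> {0..1} then min t T else 0)"

context
  fixes T :: real
  assumes T: "0 < T" "T \<le> 1"
begin

lemma cm_kernel_apply: "cm_kernel T t = (if t \<in> {0..1} then min t T else 0)"
proof -
  have "continuous_on {0..1} (\<lambda>t. if t \<in> {0..1} then min t T else 0)"
    by (subst continuous_on_cong[OF refl, of _ _ "\<lambda>t. min t T"]) (auto intro!: continuous_intros)
  then have "c0_apply (C0 (\<lambda>t. if t \<in> {0..1} then min t T else 0)) = (\<lambda>t. if t \<in> {0..1} then min t T else 0)"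
    using T by (intro C0_inverse) auto
  then show ?thesis
    by (simp add: cm_kernel_def)
qed

lemma cm_kernel_ac: "absolutely_continuous_on_interval 0 1 (c0_apply (cm_kernel T))"
  unfolding absolutely_continuous_on_interval_def
proof (intro allI impI)
  fix \<epsilon> :: real assume "\<epsilon> > 0"
  have "(\<Sum>i<m. \<bar>cm_kernel T (v i) - cm_kernel T (u i)\<bar>) \<le> (\<Sum>i<m. v i - u i)"
    if "\<forall>i<m. 0 \<le> u i \<and> u i \<le> v i \<and> v i \<le> 1" for m :: nat and u v
    using that by (intro sum_mono) (auto simp: cm_kernel_apply)
  then show "\<exists>\<delta>>0. \<forall>(m::nat) u v.
        (\<forall>i<m. 0 \<le> u i \<and> u i \<le> v i \<and> v i \<le> 1) \<and>
        disjoint_family_on (\<lambda>i. {u i<..<v i}) {..<m} \<and>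
        (\<Sum>i<m. v i - u i) < \<delta> \<longrightarrow>
        (\<Sum>i<m. \<bar>cm_kernel T (v i) - cm_kernel T (u i)\<bar>) < \<epsilon>"
    using \<open>\<epsilon> > 0\<close> by (intro exI[of _ \<epsilon>]) (auto intro: le_less_trans)
qed

lemma cm_kernel_deriv_AE: "AE t in lebesgue_on {0..1}. c0_deriv (cm_kernel T) t = indicator {0..T} t"
  unfolding AE_lebesgue_on_01_iff
  \<comment> \<open>Besides the corner at \<open>T\<close>, the ends 0 and 1 are excluded, where the
    extension by zero interferes with the two-sided derivative.\<close>
  using AE_lebesgue_neq[of 0] AE_lebesgue_neq[of 1] AE_lebesgue_neq[of T]
proof eventually_elim
  case (elim t)
  show ?case
  proof (intro impI)
    assume t: "t \<in> {0..1}"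
    show "c0_deriv (cm_kernel T) t = indicator {0..T} t"
    proof (cases "t < T")
      case True
      have "(c0_apply (cm_kernel T) has_real_derivative 1) (at t)"
        by (rule has_field_derivative_transform_within_open[of "\<lambda>t. t" _ _ "{0<..<T}"])
          (use T t elim True in \<open>auto simp: cm_kernel_apply\<close>)
      then show ?thesis
        using t True by (simp add: c0_deriv_def DERIV_imp_deriv)
    next
      case False
      have "(c0_apply (cm_kernel T) has_real_derivative 0) (at t)"
        by (rule has_field_derivative_transform_within_open[of "\<lambda>t. T" _ _ "{T<..<1}"])
          (use T t elim False in \<open>auto simp: cm_kernel_apply\<close>)
      then show ?thesis
        using t False elim by (simp add: c0_deriv_def DERIV_imp_deriv)
    qed
  qed
qed

lemma cm_kernel_in: "cm_kernel T \<in> cameron_martin"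
proof -
  have [measurable]: "indicator {0..T} \<in> borel_measurable (lebesgue_on {0..1})"
    by (intro measurable_restrict_space1 measurable_completion) measurable
  have "finite_measure (lebesgue_on {0..1::real})"
    by (rule finite_measure_lebesgue_on) simp
  then have "integrable (lebesgue_on {0..1}) (\<lambda>t. (indicator {0..T} t :: real))"
    by (intro finite_measure.integrable_const_bound[where B = 1]) (auto split: split_indicator)
  then have "integrable (lebesgue_on {0..1}) (\<lambda>t. (c0_deriv (cm_kernel T) t)\<^sup>2)"
  proof (rule integrable_cong_AE_imp)
    show "AE t in lebesgue_on {0..1}. indicator {0..T} t = (c0_deriv (cm_kernel T) t)\<^sup>2"
      using cm_kernel_deriv_AE by eventually_elim (simp add: indicator_def)
  qed (use c0_deriv_measurable[OF cm_kernel_ac] in simp)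
  then show ?thesis
    using cm_kernel_ac by (simp add: cameron_martin_def)
qed

lemma cm_inner_kernel:
  assumes "k \<in> cameron_martin"
  shows "cm_inner (cm_kernel T) k = k T"
proof -
  have T01: "T \<in> {0..1}" using T by simp
  have [measurable]: "indicator {0..T} \<in> borel_measurable (lebesgue_on {0..1})"
    by (intro measurable_restrict_space1 measurable_completion) measurable
  have "cm_inner (cm_kernel T) k = (LINT t|lebesgue_on {0..1}. indicator {0..T} t * c0_deriv k t)"
    unfolding cm_inner_def using cm_kernel_deriv_AE c0_deriv_measurable[OF cm_kernel_ac] cm_deriv_measurable[OF assms]
    by (intro integral_cong_AE) (auto elim!: eventually_mono)
  also have "\<dots> = k T"
    using integral_lebesgue_on_initial[OF T01, of "c0_deriv k"] cm_ftc[OF assms T01] by simp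
  finally show ?thesis .
qed

lemma cm_kernel_at: "cm_kernel T T = T"
  using T by (simp add: cm_kernel_apply)

text \<open>A point \<open>k\<close> of the level subspace differs from the candidate by a path
  vanishing at \<open>T\<close>, which is orthogonal to the kernel. Pythagoras gives minimality, and
  equality of norms forces the difference to be zero.\<close>

lemma cm_closest_level_subspace: "cm_closest_to_0 (level_subspace T c) = (c / T) *\<^sub>R cm_kernel T"
  unfolding cm_closest_to_0_def
proof (rule the_equality)
  let ?h = "(c / T) *\<^sub>R cm_kernel T"
  have h_in: "?h \<in> cameron_martin"
    by (intro cameron_martin_scaleR cm_kernel_in)
  have h_L: "?h \<in> level_subspace T c"
    using T h_in by (simp add: level_subspace_def cm_kernel_at)
  have pyth: "cm_inner k k = cm_inner ?h ?h + cm_inner (k - ?h) (k - ?h)" if k: "k \<in> level_subspace T c" for k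
  proof -
    have k_in: "k \<in> cameron_martin" and kT: "k T = c"
      using k by (auto simp: level_subspace_def)
    have d_in: "k - ?h \<in> cameron_martin"
      by (rule cameron_martin_diff[OF k_in h_in])
    have orth: "cm_inner ?h (k - ?h) = 0"
      using cm_inner_lincomb_left[OF cm_kernel_in cm_kernel_in d_in, of "c / T" 0] T kT
      by (simp add: cm_inner_kernel d_in cm_kernel_at)
    have "cm_inner k k = cm_inner (1 *\<^sub>R ?h + 1 *\<^sub>R (k - ?h)) (1 *\<^sub>R ?h + 1 *\<^sub>R (k - ?h))"
      by simp
    also have "\<dots> = cm_inner ?h ?h + cm_inner (k - ?h) (k - ?h)"
      unfolding cm_inner_lincomb_left[OF h_in d_in cameron_martin_lincomb[OF h_in d_in]]
        cm_inner_lincomb_right[OF h_in d_in h_in] cm_inner_lincomb_right[OF h_in d_in d_in]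
        cm_inner_commute[of "k - ?h" ?h] orth by simp
    finally show ?thesis .
  qed
  show "?h \<in> level_subspace T c \<and> (\<forall>k\<in>level_subspace T c. cm_norm ?h \<le> cm_norm k)"
  proof (intro conjI ballI h_L)
    fix k assume "k \<in> level_subspace T c"
    then show "cm_norm ?h \<le> cm_norm k"
      using pyth[of k] cm_inner_self_nonneg[of "k - ?h"] unfolding cm_norm_def
      by (intro real_sqrt_le_mono) linarith
  qed
  fix k assume k: "k \<in> level_subspace T c \<and> (\<forall>l\<in>level_subspace T c. cm_norm k \<le> cm_norm l)"
  then have "cm_inner k k \<le> cm_inner ?h ?h"
    using h_L real_sqrt_le_iff unfolding cm_norm_def by blast
  then have "cm_inner (k - ?h) (k - ?h) = 0"
    using pyth[of k] k cm_inner_self_nonneg[of "k - ?h"] by linarith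
  then have "k - ?h = 0"
    using k by (intro cm_inner_self_eq_0 cameron_martin_diff h_in) (auto simp: level_subspace_def)
  then show "k = ?h" by simp
qed

lemma level_subspace_translate:
  "(\<lambda>h. h - (c / T) *\<^sub>R cm_kernel T) ` level_subspace T c = level_subspace T 0"
proof (intro equalityI subsetI)
  fix k assume "k \<in> (\<lambda>h. h - (c / T) *\<^sub>R cm_kernel T) ` level_subspace T c"
  then show "k \<in> level_subspace T 0"
    using T by (auto simp: level_subspace_def cm_kernel_at intro!: cameron_martin_diff cameron_martin_scaleR cm_kernel_in)
next
  fix k assume k: "k \<in> level_subspace T 0"
  have "1 *\<^sub>R k + (c / T) *\<^sub>R cm_kernel T \<in> level_subspace T c"
    using k T cameron_martin_lincomb[OF _ cm_kernel_in, of k 1 "c / T"] by (auto simp: level_subspace_def cm_kernel_at)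
  then show "k \<in> (\<lambda>h. h - (c / T) *\<^sub>R cm_kernel T) ` level_subspace T c"
    by (intro image_eqI[of _ _ "1 *\<^sub>R k + (c / T) *\<^sub>R cm_kernel T"]) auto
qed

lemma cm_proj_level_subspace:
  assumes "h \<in> cameron_martin"
  shows "cm_proj (level_subspace T 0) h = h - (h T / T) *\<^sub>R cm_kernel T"
  unfolding cm_proj_def
proof (rule the_equality)
  let ?p = "h - (h T / T) *\<^sub>R cm_kernel T"
  have p_in: "?p \<in> cameron_martin"
    by (intro cameron_martin_diff assms cameron_martin_scaleR cm_kernel_in)
  have p_M: "?p \<in> level_subspace T 0"
    using p_in T by (simp add: level_subspace_def cm_kernel_at)
  have orth: "cm_inner (h - ?p) k = 0" if "k \<in> level_subspace T 0" for k
    using that cm_inner_lincomb_left[OF cm_kernel_in cm_kernel_in, of k "h T / T" 0]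
    by (simp add: level_subspace_def cm_inner_kernel)
  show "?p \<in> level_subspace T 0 \<and> (\<forall>k\<in>level_subspace T 0. cm_inner (h - ?p) k = 0)"
    using p_M orth by blast
  fix p assume p: "p \<in> level_subspace T 0 \<and> (\<forall>k\<in>level_subspace T 0. cm_inner (h - p) k = 0)"
  have "p \<in> cameron_martin"
    using p by (simp add: level_subspace_def)
  then have d_in: "p - ?p \<in> cameron_martin"
    by (intro cameron_martin_diff p_in)
  have d_M: "p - ?p \<in> level_subspace T 0"
    using d_in p p_M by (simp add: level_subspace_def)
  \<comment> \<open>The difference of two candidates is the difference of their residuals. Both
    residuals are orthogonal to the subspace, which contains that difference, so it is orthogonal to
    itself.\<close>
  have "cm_inner (p - ?p) (p - ?p) = cm_inner (1 *\<^sub>R (h - ?p) + (- 1) *\<^sub>R (h - p)) (p - ?p)"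
    by (simp add: algebra_simps)
  also have "\<dots> = 1 * cm_inner (h - ?p) (p - ?p) + (- 1) * cm_inner (h - p) (p - ?p)"
    using cameron_martin_diff[OF assms p_in] cameron_martin_diff[OF assms \<open>p \<in> cameron_martin\<close>] d_in
    by (rule cm_inner_lincomb_left)
  also have "\<dots> = 0"
    using orth[OF d_M] p d_M by simp
  finally have "p - ?p = 0"
    by (rule cm_inner_self_eq_0[OF d_in])
  then show "p = ?p" by simp
qed

lemma cm_norm_proj_level_subspace:
  assumes "h \<in> cameron_martin"
  shows "(cm_norm (cm_proj (level_subspace T 0) h))\<^sup>2 = cm_inner h h - (h T)\<^sup>2 / T"
proof -
  let ?a = "- (h T / T)"
  have "(cm_norm (cm_proj (level_subspace T 0) h))\<^sup>2 =
      cm_inner (1 *\<^sub>R h + ?a *\<^sub>R cm_kernel T) (1 *\<^sub>R h + ?a *\<^sub>R cm_kernel T)"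
    by (simp add: cm_norm_sq cm_proj_level_subspace[OF assms])
  also have "\<dots> = cm_inner h h + 2 * ?a * cm_inner (cm_kernel T) h + ?a\<^sup>2 * cm_inner (cm_kernel T) (cm_kernel T)"
    unfolding cm_inner_lincomb_left[OF assms cm_kernel_in cameron_martin_lincomb[OF assms cm_kernel_in]]
      cm_inner_lincomb_right[OF assms cm_kernel_in assms]
      cm_inner_lincomb_right[OF assms cm_kernel_in cm_kernel_in] cm_inner_commute[of h "cm_kernel T"]
    by (simp add: power2_eq_square algebra_simps)
  also have "\<dots> = cm_inner h h - (h T)\<^sup>2 / T"
    using T by (simp add: cm_inner_kernel assms cm_kernel_in cm_kernel_at power2_eq_square field_simps)
  finally show ?thesis .
qed

lemma conditioned_measure_char:
  assumes "conditioned_measure \<mu> (level_subspace T c) \<nu>" "h \<in> cameron_martin" "is_I_functional \<mu> h \<phi>"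
  shows "(LINT \<omega>|\<nu>. exp (\<i> * complex_of_real (\<phi> \<omega>))) =
    exp (\<i> * complex_of_real (c * h T / T) - complex_of_real ((cm_inner h h - (h T)\<^sup>2 / T) / 2))"
proof -
  have "h \<in> cameron_martin_dual \<mu>"
    using assms by (auto simp: cameron_martin_dual_def)
  moreover have "cm_inner ((c / T) *\<^sub>R cm_kernel T) h = c * h T / T"
    using cm_inner_lincomb_left[OF cm_kernel_in cm_kernel_in assms(2), of "c / T" 0] assms(2)
    by (simp add: cm_inner_kernel)
  moreover have "(LINT \<omega>|\<nu>. exp (\<i> * complex_of_real (\<phi> \<omega>))) =
      exp (\<i> * complex_of_real (cm_inner ((c / T) *\<^sub>R cm_kernel T) h) -
        complex_of_real ((cm_norm (cm_proj (level_subspace T 0) h))\<^sup>2 / 2))"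
    if "h \<in> cameron_martin_dual \<mu>"
    using assms that
    unfolding conditioned_measure_def Let_def cm_closest_level_subspace level_subspace_translate by blast
  ultimately show ?thesis
    by (simp only: cm_norm_proj_level_subspace[OF assms(2)])
qed

end

section \<open>Hermite polynomials and Gaussian moments\<close>

text \<open>This is the condition in the definite description of \<open>hermite\<close>. Convergence
  for all real \<open>t\<close> determines the coefficients and is absolute, so identities between
  generating functions become identities between coefficients.\<close>

definition egf_sums :: "(nat \<Rightarrow> real) \<Rightarrow> (real \<Rightarrow> real) \<Rightarrow> bool" where
  "egf_sums a A \<longleftrightarrow> (\<forall>t. (\<lambda>k. t ^ k / fact k * a k) sums A t)"

lemma egf_sums_unique:
  assumes "egf_sums a A" "egf_sums b A"
  shows "a = b"
proof (rule ccontr)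
  define d where "d = (\<lambda>k. (a k - b k) / fact k)"
  assume "a \<noteq> b"
  then have ex: "\<exists>n. d n \<noteq> 0"
    by (auto simp: d_def fun_eq_iff)
  define n where "n = (LEAST n. d n \<noteq> 0)"
  have dn: "d n \<noteq> 0"
    unfolding n_def by (rule LeastI_ex[OF ex])
  have d0: "d k = 0" if "k < n" for k
    using not_less_Least[of k "\<lambda>n. d n \<noteq> 0"] that by (simp add: n_def)
  have "(\<lambda>k. t ^ k / fact k * a k - t ^ k / fact k * b k) sums (A t - A t)" for t
    using assms unfolding egf_sums_def by (intro sums_diff) auto
  then have sums: "(\<lambda>k. d k * t ^ k) sums 0" for t
    by (simp add: d_def algebra_simps diff_divide_distrib)
  \<comment> \<open>Dropping the zero terms below \<open>n\<close> and dividing by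
    \<open>t ^ n\<close> leaves a power series with sum 0 for every \<open>t \<noteq> 0\<close>; its
    constant term \<open>d n\<close> is the limit at 0.\<close>
  have "((\<lambda>_. 0) \<longlongrightarrow> d (0 + n)) (at (0::real))"
  proof (rule powser_limit_0_strong[of 1])
    fix t :: real assume "t \<noteq> 0"
    have "(\<lambda>k. d (k + n) * t ^ (k + n)) sums (0 - (\<Sum>k<n. d k * t ^ k))"
      by (rule sums_split_initial_segment[OF sums])
    then have "(\<lambda>k. d (k + n) * t ^ (k + n) / t ^ n) sums (0 / t ^ n)"
      using d0 by (intro sums_divide) simp
    then show "(\<lambda>k. d (k + n) * t ^ k) sums 0"
      using \<open>t \<noteq> 0\<close> by (simp add: power_add)
  qed simp
  then have "d n = 0"
    by (simp add: tendsto_const_iff)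
  with dn show False by simp
qed

text \<open>A power series that converges at \<open>\<bar>t\<bar> + 1\<close> converges absolutely
  at \<open>t\<close>. Cauchy products rely on this.\<close>

lemma egf_sums_abs_summable:
  assumes "egf_sums a A"
  shows "summable (\<lambda>k. norm (t ^ k / fact k * a k))"
proof -
  have "summable (\<lambda>k. a k / fact k * (\<bar>t\<bar> + 1) ^ k)"
    using assms unfolding egf_sums_def by (auto simp: sums_iff mult.commute)
  then have "summable (\<lambda>k. norm (a k / fact k * t ^ k))"
    by (rule powser_insidea) simp
  then show ?thesis
    by (simp add: mult.commute)
qed

lemma egf_sums_mult:
  assumes "egf_sums a A" "egf_sums b B"
  shows "egf_sums (\<lambda>n. \<Sum>k\<le>n. real (n choose k) * a k * b (n - k)) (\<lambda>t. A t * B t)"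
  unfolding egf_sums_def
proof
  fix t
  have "(\<Sum>k. t ^ k / fact k * a k) = A t" "(\<Sum>k. t ^ k / fact k * b k) = B t"
    using assms unfolding egf_sums_def by (simp_all add: sums_iff)
  then have "(\<lambda>n. \<Sum>k\<le>n. t ^ k / fact k * a k * (t ^ (n - k) / fact (n - k) * b (n - k))) sums (A t * B t)"
    using Cauchy_product_sums[OF egf_sums_abs_summable[OF assms(1), of t] egf_sums_abs_summable[OF assms(2), of t]]
    by simp
  moreover have "(\<Sum>k\<le>n. t ^ k / fact k * a k * (t ^ (n - k) / fact (n - k) * b (n - k))) =
      t ^ n / fact n * (\<Sum>k\<le>n. real (n choose k) * a k * b (n - k))" for n
    unfolding sum_distrib_left
  proof (rule sum.cong[OF refl])
    fix k assume "k \<in> {..n}"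
    then have k: "k \<le> n" by simp
    then have "t ^ n = t ^ k * t ^ (n - k)"
      by (simp flip: power_add)
    then show "t ^ k / fact k * a k * (t ^ (n - k) / fact (n - k) * b (n - k)) =
        t ^ n / fact n * (real (n choose k) * a k * b (n - k))"
      by (simp add: binomial_fact[OF k])
  qed
  ultimately show "(\<lambda>n. t ^ n / fact n * (\<Sum>k\<le>n. real (n choose k) * a k * b (n - k))) sums (A t * B t)"
    by simp
qed

lemma egf_sums_power: "egf_sums (\<lambda>k. x ^ k) (\<lambda>t. exp (t * x))"
  unfolding egf_sums_def
proof
  fix t
  have "(t * x) ^ k /\<^sub>R fact k = t ^ k / fact k * x ^ k" for k
    by (simp only: real_scaleR_def power_mult_distrib divide_inverse mult_ac)
  then show "(\<lambda>k. t ^ k / fact k * x ^ k) sums exp (t * x)"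
    using exp_converges[of "t * x"] by (simp only:)
qed

text \<open>For \<open>v \<ge> 0\<close> the coefficients are the moments of the centred Gaussian of
  variance \<open>v\<close>. The sign of \<open>v\<close> is left free because \<open>- v\<close>
  enters the construction of the Hermite polynomials.\<close>

lemma egf_sums_gauss:
  "egf_sums (\<lambda>k. if even k then fact k / fact (k div 2) * (v / 2) ^ (k div 2) else 0) (\<lambda>t. exp (v / 2 * t\<^sup>2))"
  unfolding egf_sums_def
proof
  fix t
  let ?f = "\<lambda>k. t ^ k / fact k * (if even k then fact k / fact (k div 2) * (v / 2) ^ (k div 2) else 0)"
  have "y ^ j /\<^sub>R fact j = y ^ j / fact j" for y :: real and j
    by (simp only: real_scaleR_def divide_inverse mult_ac)
  then have "(\<lambda>j. (v / 2 * t\<^sup>2) ^ j / fact j) sums exp (v / 2 * t\<^sup>2)"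
    using exp_converges[of "v / 2 * t\<^sup>2"] by (simp only:)
  moreover have "(v / 2 * t\<^sup>2) ^ j / fact j = ?f (2 * j)" for j
  proof -
    have "(v / 2 * t\<^sup>2) ^ j = (v / 2) ^ j * t ^ (2 * j)"
      by (simp only: power_mult_distrib power_mult)
    then show ?thesis by simp
  qed
  ultimately have "(\<lambda>j. ?f (2 * j)) sums exp (v / 2 * t\<^sup>2)"
    by simp
  then show "?f sums exp (v / 2 * t\<^sup>2)"
    by (subst (asm) sums_mono_reindex) (auto simp: strict_mono_def image_iff elim!: evenE)
qed

text \<open>The coefficients exist because the generating function factors into two known ones, and
  they are unique; hence the definite description in \<open>hermite\<close> denotes.\<close>

lemma egf_sums_hermite: "egf_sums (\<lambda>n. hermite n x v) (\<lambda>t. exp (t * x - v / 2 * t\<^sup>2))"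
proof -
  have "\<exists>H. egf_sums H (\<lambda>t. exp (t * x - v / 2 * t\<^sup>2))"
    using egf_sums_mult[OF egf_sums_power[of x] egf_sums_gauss[of "- v"]] by (auto simp: exp_add[symmetric])
  then have "\<exists>!H. egf_sums H (\<lambda>t. exp (t * x - v / 2 * t\<^sup>2))"
    using egf_sums_unique by blast
  then have "egf_sums (THE H. egf_sums H (\<lambda>t. exp (t * x - v / 2 * t\<^sup>2))) (\<lambda>t. exp (t * x - v / 2 * t\<^sup>2))"
    by (rule theI')
  then show ?thesis
    by (simp add: hermite_def egf_sums_def)
qed

text \<open>Replacing \<open>t\<close> by \<open>t * l\<close> in the generating function. The case
  \<open>l = 0\<close> is included, so paths with \<open>h T = 0\<close> need no separate
  treatment.\<close>

lemma hermite_scale: "hermite n (l * x) (l\<^sup>2 * v) = l ^ n * hermite n x v"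
proof -
  have "egf_sums (\<lambda>n. l ^ n * hermite n x v) (\<lambda>t. exp (t * (l * x) - (l\<^sup>2 * v) / 2 * t\<^sup>2))"
    unfolding egf_sums_def
  proof
    fix t
    have "(\<lambda>k. (t * l) ^ k / fact k * hermite k x v) sums exp ((t * l) * x - v / 2 * (t * l)\<^sup>2)"
      using egf_sums_hermite[of x v] unfolding egf_sums_def by blast
    then show "(\<lambda>k. t ^ k / fact k * (l ^ k * hermite k x v)) sums exp (t * (l * x) - (l\<^sup>2 * v) / 2 * t\<^sup>2)"
      by (simp add: power_mult_distrib mult_ac)
  qed
  from egf_sums_unique[OF this egf_sums_hermite] show ?thesis
    by (simp add: fun_eq_iff)
qed

text \<open>Multiplying the generating function by \<open>exp (t * y)\<close>. The right-hand side
  is visibly a polynomial in \<open>y\<close>, from which measurability and integrability are read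
  off.\<close>

lemma hermite_add: "hermite n (m + y) s = (\<Sum>k\<le>n. real (n choose k) * hermite k m s * y ^ (n - k))"
proof -
  have "egf_sums (\<lambda>n. \<Sum>k\<le>n. real (n choose k) * hermite k m s * y ^ (n - k))
      (\<lambda>t. exp (t * (m + y) - s / 2 * t\<^sup>2))"
    using egf_sums_mult[OF egf_sums_hermite[of m s] egf_sums_power[of y]]
    by (simp add: exp_add[symmetric] algebra_simps)
  from egf_sums_unique[OF this egf_sums_hermite] show ?thesis
    by (simp add: fun_eq_iff)
qed

text \<open>The moments are brought into the form of the coefficients in
  \<open>egf_sums_gauss\<close> with \<open>v = \<sigma>\<^sup>2\<close>.\<close>

lemma std_normal_moment:
  "(LINT z|std_normal_distribution. (\<sigma> * z) ^ k) =
    (if even k then fact k / fact (k div 2) * (\<sigma>\<^sup>2 / 2) ^ (k div 2) else 0)"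
proof (cases "even k")
  case True
  then obtain j where k: "k = 2 * j" by (elim evenE)
  have "(LINT z|std_normal_distribution. (\<sigma> * z) ^ k) = \<sigma> ^ k * (LINT z|std_normal_distribution. z ^ k)"
    by (simp add: power_mult_distrib)
  also have "\<dots> = (\<sigma>\<^sup>2) ^ j * (fact (2 * j) / (2 ^ j * fact j))"
    unfolding k std_normal_distribution_even_moments by (simp add: power_mult)
  finally show ?thesis
    using k by (simp add: power_divide mult_ac)
next
  case False
  then show ?thesis
    by (simp add: power_mult_distrib integral_std_normal_distribution_moment_odd)
qed

lemma integrable_hermite_gaussian: "integrable std_normal_distribution (\<lambda>z. hermite n (m + \<sigma> * z) s)"
  unfolding hermite_add power_mult_distrib
  by (intro Bochner_Integration.integrable_sum integrable_mult_right integrable_std_normal_distribution_moment)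

text \<open>By \<open>hermite_add\<close> the integral is a finite binomial convolution of Hermite
  values with Gaussian moments. Its generating function is a product, so the integral never has to
  be exchanged with an infinite series.\<close>

lemma integral_hermite_gaussian:
  "(LINT z|std_normal_distribution. hermite n (m + \<sigma> * z) s) = hermite n m (s - \<sigma>\<^sup>2)"
proof -
  have "(LINT z|std_normal_distribution. hermite n (m + \<sigma> * z) s) =
      (\<Sum>k\<le>n. real (n choose k) * hermite k m s * (LINT z|std_normal_distribution. (\<sigma> * z) ^ (n - k)))" for n
    unfolding hermite_add
    by (subst Bochner_Integration.integral_sum)
      (auto simp: power_mult_distrib intro!: integrable_mult_right integrable_std_normal_distribution_moment)
  moreover have "egf_sums (\<lambda>n. \<Sum>k\<le>n. real (n choose k) * hermite k m s * (LINT z|std_normal_distribution. (\<sigma> * z) ^ (n - k)))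
      (\<lambda>t. exp (t * m - s / 2 * t\<^sup>2) * exp (\<sigma>\<^sup>2 / 2 * t\<^sup>2))"
    unfolding std_normal_moment by (rule egf_sums_mult[OF egf_sums_hermite egf_sums_gauss])
  moreover have "exp (t * m - s / 2 * t\<^sup>2) * exp (\<sigma>\<^sup>2 / 2 * t\<^sup>2) = exp (t * m - (s - \<sigma>\<^sup>2) / 2 * t\<^sup>2)" for t :: real
    by (simp add: exp_add[symmetric] field_simps)
  ultimately have "egf_sums (\<lambda>n. LINT z|std_normal_distribution. hermite n (m + \<sigma> * z) s)
      (\<lambda>t. exp (t * m - (s - \<sigma>\<^sup>2) / 2 * t\<^sup>2))"
    by simp
  from egf_sums_unique[OF this egf_sums_hermite] show ?thesis
    by (simp add: fun_eq_iff)
qed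

text \<open>The variance \<open>v\<close> may vanish: the law is then a point mass.\<close>

lemma (in prob_space) distr_eq_gaussian:
  assumes X [measurable]: "X \<in> borel_measurable M" and "v \<ge> 0"
    and char: "\<And>s. (CLINT \<omega>|M. exp (\<i> * complex_of_real (s * X \<omega>))) =
      exp (\<i> * complex_of_real (s * m) - complex_of_real (s\<^sup>2 * v / 2))"
  shows "distr M borel X = distr std_normal_distribution borel (\<lambda>z. m + sqrt v * z)"
proof (rule Levy_uniqueness)
  have [simp]: "prob_space std_normal_distribution"
    using real_dist_normal_dist by (simp add: real_distribution_def)
  show "real_distribution (distr M borel X)"
    by (rule real_distribution_distr) simp
  show "real_distribution (distr std_normal_distribution borel (\<lambda>z. m + sqrt v * z))"
    by (rule prob_space.real_distribution_distr) auto
  show "Characteristic_Functions.char (distr M borel X) =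
      Characteristic_Functions.char (distr std_normal_distribution borel (\<lambda>z. m + sqrt v * z))"
  proof
    fix s
    have "Characteristic_Functions.char (distr std_normal_distribution borel (\<lambda>z. m + sqrt v * z)) s =
        (CLINT z|std_normal_distribution. exp (\<i> * complex_of_real (s * m)) * exp (\<i> * complex_of_real (s * sqrt v * z)))"
      unfolding Characteristic_Functions.char_def
      by (subst integral_distr) (auto simp: exp_add[symmetric] algebra_simps)
    also have "\<dots> = exp (\<i> * complex_of_real (s * m)) * Characteristic_Functions.char std_normal_distribution (s * sqrt v)"
      by (simp add: Characteristic_Functions.char_def)
    also have "\<dots> = exp (\<i> * complex_of_real (s * m)) * exp (complex_of_real (- (s\<^sup>2 * v / 2)))"
    proof -
      have "- ((s * sqrt v)\<^sup>2) / 2 = - (s\<^sup>2 * v / 2)"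
        using \<open>v \<ge> 0\<close> by (simp add: power_mult_distrib)
      then show ?thesis
        by (simp only: char_std_normal_distribution exp_of_real)
    qed
    also have "\<dots> = exp (\<i> * complex_of_real (s * m) - complex_of_real (s\<^sup>2 * v / 2))"
      by (simp add: exp_add[symmetric])
    finally show "Characteristic_Functions.char (distr M borel X) s =
        Characteristic_Functions.char (distr std_normal_distribution borel (\<lambda>z. m + sqrt v * z)) s"
      unfolding char[symmetric] unfolding Characteristic_Functions.char_def by (subst integral_distr) auto
  qed
qed

section \<open>Linearity of the Wiener integral\<close>

lemma L2_null_lincomb:
  fixes f g :: "nat \<Rightarrow> 'a \<Rightarrow> real"
  assumes f: "(\<lambda>k. \<integral>\<^sup>+x. ennreal ((f k x)\<^sup>2) \<partial>M) \<longlonglongrightarrow> 0" "\<And>k. f k \<in> borel_measurable M"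
    and g: "(\<lambda>k. \<integral>\<^sup>+x. ennreal ((g k x)\<^sup>2) \<partial>M) \<longlonglongrightarrow> 0" "\<And>k. g k \<in> borel_measurable M"
  shows "(\<lambda>k. \<integral>\<^sup>+x. ennreal ((a * f k x + b * g k x)\<^sup>2) \<partial>M) \<longlonglongrightarrow> 0"
proof (rule tendsto_sandwich[OF _ _ tendsto_const])
  note [measurable] = f(2) g(2)
  let ?u = "\<lambda>k. ennreal (2 * a\<^sup>2) * (\<integral>\<^sup>+x. ennreal ((f k x)\<^sup>2) \<partial>M) + ennreal (2 * b\<^sup>2) * (\<integral>\<^sup>+x. ennreal ((g k x)\<^sup>2) \<partial>M)"
  have "?u \<longlonglongrightarrow> ennreal (2 * a\<^sup>2) * 0 + ennreal (2 * b\<^sup>2) * 0"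
    by (intro tendsto_add ennreal_tendsto_cmult f g) auto
  then show "?u \<longlonglongrightarrow> 0" by simp
  have "(\<integral>\<^sup>+x. ennreal ((a * f k x + b * g k x)\<^sup>2) \<partial>M) \<le> ?u k" for k
  proof -
    \<comment> \<open>The right-hand side exceeds the left by
      \<open>(a * f k x - b * g k x)\<^sup>2\<close>.\<close>
    have "(a * f k x + b * g k x)\<^sup>2 \<le> 2 * a\<^sup>2 * (f k x)\<^sup>2 + 2 * b\<^sup>2 * (g k x)\<^sup>2" for x
      using zero_le_power2[of "a * f k x - b * g k x"] by (simp add: power2_eq_square algebra_simps)
    then have "(\<integral>\<^sup>+x. ennreal ((a * f k x + b * g k x)\<^sup>2) \<partial>M) \<le>
        (\<integral>\<^sup>+x. ennreal (2 * a\<^sup>2) * ennreal ((f k x)\<^sup>2) + ennreal (2 * b\<^sup>2) * ennreal ((g k x)\<^sup>2) \<partial>M)"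
      by (intro nn_integral_mono) (simp flip: ennreal_mult' ennreal_plus)
    also have "\<dots> = ?u k"
      by (simp add: nn_integral_add nn_integral_cmult)
    finally show ?thesis .
  qed
  then show "\<forall>\<^sub>F k in sequentially. (\<integral>\<^sup>+x. ennreal ((a * f k x + b * g k x)\<^sup>2) \<partial>M) \<le> ?u k"
    by simp
qed simp

lemma bounded_linear_c0_apply: "bounded_linear (\<lambda>\<omega>. c0_apply \<omega> t)"
  by (rule bounded_linear_intro[where K = 1]) (auto intro: abs_c0_apply_le_norm)

lemma bounded_linear_borel_measurable:
  assumes "bounded_linear (\<phi> :: c0 \<Rightarrow> real)" "sets M = sets borel"
  shows "\<phi> \<in> borel_measurable M"
  using borel_measurable_continuous_onI[OF linear_continuous_on[OF assms(1)]] assms(2)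
  by (simp cong: measurable_cong_sets)

definition scale_steps :: "real \<Rightarrow> (real \<times> real \<times> real) list \<Rightarrow> (real \<times> real \<times> real) list" where
  "scale_steps a xs = map (\<lambda>(c, u, v). (a * c, u, v)) xs"

lemma step_list_lincomb: "step_list xs \<Longrightarrow> step_list ys \<Longrightarrow> step_list (scale_steps a xs @ scale_steps b ys)"
  by (auto simp: step_list_def scale_steps_def)

lemma step_fun_lincomb:
  "step_fun (scale_steps a xs @ scale_steps b ys) t = a * step_fun xs t + b * step_fun ys t"
proof -
  have "step_fun (scale_steps a xs) t = a * step_fun xs t" for a xs
    by (induction xs) (auto simp: step_fun_def scale_steps_def algebra_simps)
  then show ?thesis by (simp add: step_fun_def)
qed

lemma step_wiener_integral_lincomb:
  "step_wiener_integral (scale_steps a xs @ scale_steps b ys) \<omega> =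
    a * step_wiener_integral xs \<omega> + b * step_wiener_integral ys \<omega>"
proof -
  have "step_wiener_integral (scale_steps a xs) \<omega> = a * step_wiener_integral xs \<omega>" for a xs
    by (induction xs) (auto simp: step_wiener_integral_def scale_steps_def algebra_simps)
  then show ?thesis by (simp add: step_wiener_integral_def)
qed

lemma step_fun_measurable: "step_fun xs \<in> borel_measurable (lebesgue_on {0..1})"
proof -
  have "step_fun xs \<in> borel_measurable borel"
    by (induction xs) (auto simp: step_fun_def[abs_def] split_def)
  then show ?thesis
    by (intro measurable_restrict_space1 measurable_completion) simp
qed

lemma step_wiener_integral_measurable:
  assumes "sets \<mu> = sets borel"
  shows "step_wiener_integral xs \<in> borel_measurable \<mu>"
proof -
  have [measurable]: "(\<lambda>\<omega>. c0_apply \<omega> t) \<in> borel_measurable \<mu>" for t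
    by (rule bounded_linear_borel_measurable[OF bounded_linear_c0_apply assms])
  show ?thesis
    by (induction xs) (auto simp: step_wiener_integral_def[abs_def] split_def)
qed

text \<open>Scaling and concatenating the approximating step lists gives one sequence that serves
  for both mean square limits, that of the integrands and that of the integrals. Multiples are used
  to find the law of \<open>I(h)\<close>, sums for polarization.\<close>

lemma is_I_functional_lincomb:
  assumes sets: "sets \<mu> = sets borel"
    and h: "h \<in> cameron_martin" "is_I_functional \<mu> h \<phi>"
    and k: "k \<in> cameron_martin" "is_I_functional \<mu> k \<psi>"
  shows "is_I_functional \<mu> (a *\<^sub>R h + b *\<^sub>R k) (\<lambda>\<omega>. a * \<phi> \<omega> + b * \<psi> \<omega>)"
proof -
  note [measurable] = cm_deriv_measurable[OF h(1)] cm_deriv_measurable[OF k(1)] step_fun_measurable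
    step_wiener_integral_measurable[OF sets]
  obtain xs where phi: "bounded_linear \<phi>" "\<phi> \<in> borel_measurable \<mu>" "\<And>i. step_list (xs i)"
    "(\<lambda>i. \<integral>\<^sup>+ t. ennreal ((c0_deriv h t - step_fun (xs i) t)\<^sup>2) \<partial>lebesgue_on {0..1}) \<longlonglongrightarrow> 0"
    "(\<lambda>i. \<integral>\<^sup>+ \<omega>. ennreal ((\<phi> \<omega> - step_wiener_integral (xs i) \<omega>)\<^sup>2) \<partial>\<mu>) \<longlonglongrightarrow> 0"
    using h(2) unfolding is_I_functional_def is_wiener_integral_def by blast
  obtain ys where psi: "bounded_linear \<psi>" "\<psi> \<in> borel_measurable \<mu>" "\<And>i. step_list (ys i)"
    "(\<lambda>i. \<integral>\<^sup>+ t. ennreal ((c0_deriv k t - step_fun (ys i) t)\<^sup>2) \<partial>lebesgue_on {0..1}) \<longlonglongrightarrow> 0"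
    "(\<lambda>i. \<integral>\<^sup>+ \<omega>. ennreal ((\<psi> \<omega> - step_wiener_integral (ys i) \<omega>)\<^sup>2) \<partial>\<mu>) \<longlonglongrightarrow> 0"
    using k(2) unfolding is_I_functional_def is_wiener_integral_def by blast
  note [measurable] = phi(2) psi(2)
  let ?l = "a *\<^sub>R h + b *\<^sub>R k" and ?zs = "\<lambda>i. scale_steps a (xs i) @ scale_steps b (ys i)"
  have "(\<lambda>i. \<integral>\<^sup>+ t. ennreal ((a * (c0_deriv h t - step_fun (xs i) t) + b * (c0_deriv k t - step_fun (ys i) t))\<^sup>2) \<partial>lebesgue_on {0..1}) \<longlonglongrightarrow> 0"
    by (rule L2_null_lincomb[OF phi(4) _ psi(4)]) measurable
  moreover have "(\<integral>\<^sup>+ t. ennreal ((a * (c0_deriv h t - step_fun (xs i) t) + b * (c0_deriv k t - step_fun (ys i) t))\<^sup>2) \<partial>lebesgue_on {0..1}) =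
      (\<integral>\<^sup>+ t. ennreal ((c0_deriv ?l t - step_fun (?zs i) t)\<^sup>2) \<partial>lebesgue_on {0..1})" for i
  proof (rule nn_integral_cong_AE)
    show "AE t in lebesgue_on {0..1}. ennreal ((a * (c0_deriv h t - step_fun (xs i) t) + b * (c0_deriv k t - step_fun (ys i) t))\<^sup>2) =
        ennreal ((c0_deriv ?l t - step_fun (?zs i) t)\<^sup>2)"
      using c0_deriv_lincomb_AE[OF h(1) k(1), of a b]
      by eventually_elim (simp add: step_fun_lincomb algebra_simps)
  qed
  moreover have "(\<lambda>i. \<integral>\<^sup>+ \<omega>. ennreal ((a * (\<phi> \<omega> - step_wiener_integral (xs i) \<omega>) + b * (\<psi> \<omega> - step_wiener_integral (ys i) \<omega>))\<^sup>2) \<partial>\<mu>) \<longlonglongrightarrow> 0"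
    by (rule L2_null_lincomb[OF phi(5) _ psi(5)]) measurable
  moreover have "a * (\<phi> \<omega> - step_wiener_integral (xs i) \<omega>) + b * (\<psi> \<omega> - step_wiener_integral (ys i) \<omega>) =
      a * \<phi> \<omega> + b * \<psi> \<omega> - step_wiener_integral (?zs i) \<omega>" for i \<omega>
    by (simp add: step_wiener_integral_lincomb algebra_simps)
  moreover have "bounded_linear (\<lambda>\<omega>. a * \<phi> \<omega> + b * \<psi> \<omega>)"
    by (intro bounded_linear_add bounded_linear_const_mult phi(1) psi(1))
  moreover have "(\<lambda>\<omega>. a * \<phi> \<omega> + b * \<psi> \<omega>) \<in> borel_measurable \<mu>"
    by measurable
  ultimately show ?thesis
    unfolding is_I_functional_def is_wiener_integral_def
    by (intro conjI exI[of _ ?zs]) (auto intro!: step_list_lincomb phi(3) psi(3))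
qed

lemma cameron_martin_dual_lincomb:
  assumes "sets \<mu> = sets borel" "h \<in> cameron_martin_dual \<mu>" "k \<in> cameron_martin_dual \<mu>"
  shows "a *\<^sub>R h + b *\<^sub>R k \<in> cameron_martin_dual \<mu>"
  using assms cameron_martin_lincomb is_I_functional_lincomb[OF assms(1)]
  unfolding cameron_martin_dual_def by blast

section \<open>Integrals of tensors over cubes\<close>

lemma prob_space_lebesgue_on_01: "prob_space (lebesgue_on {0..1::real})"
  by (rule prob_spaceI) (simp add: emeasure_restrict_space)

lemma AE_lebesgue_cube_component:
  assumes "AE x in lebesgue_on {0..1}. P x" "j < n"
  shows "AE t in lebesgue_cube n. P (t j)"
  unfolding lebesgue_cube_def
  by (rule AE_completion, rule AE_PiM_component[where P = P])
    (use assms(2) in \<open>simp_all add: assms(1) prob_space_lebesgue_on_01\<close>)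

lemma tensor_measurable_PiM:
  assumes "\<And>j. j < n \<Longrightarrow> g j \<in> borel_measurable (lebesgue_on {0..1})"
  shows "tensor n g \<in> borel_measurable (\<Pi>\<^sub>M i\<in>{..<n}. lebesgue_on {0..1})"
  unfolding tensor_def[abs_def]
proof (rule borel_measurable_prod)
  fix j assume "j \<in> {..<n}"
  then show "(\<lambda>t. g j (t j)) \<in> borel_measurable (\<Pi>\<^sub>M i\<in>{..<n}. lebesgue_on {0..1})"
    by (intro measurable_compose[OF measurable_component_singleton[of j] assms[of j]]) auto
qed

lemma tensor_measurable:
  assumes "\<And>j. j < n \<Longrightarrow> g j \<in> borel_measurable (lebesgue_on {0..1})"
  shows "tensor n g \<in> borel_measurable (lebesgue_cube n)"
  unfolding lebesgue_cube_def by (intro measurable_completion tensor_measurable_PiM assms)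

lemma subcube_in_sets:
  fixes T :: real and n :: nat
  assumes "T \<le> 1"
  shows "({..<n} \<rightarrow>\<^sub>E {0..T}) \<in> sets (\<Pi>\<^sub>M i\<in>{..<n}. lebesgue_on {0..1})"
proof (rule sets_PiM_I_finite)
  have "{0..T} = {0..1} \<inter> {0..T}"
    using assms by auto
  then show "{0..T} \<in> sets (lebesgue_on {0..1})" for i
    unfolding sets_restrict_space by (intro image_eqI[of _ _ "{0..T}"]) auto
  show "finite {..<n}" by simp
qed

text \<open>Points of the product space are extensional, so membership in the subcube is a condition
  on the coordinates alone and its indicator factorizes.\<close>

lemma indicator_subcube_mult_tensor:
  fixes T :: real
  assumes "t \<in> space (\<Pi>\<^sub>M i\<in>{..<n}. lebesgue_on {0..1})"
  shows "indicator ({..<n} \<rightarrow>\<^sub>E {0..T}) t * tensor n g t = tensor n (\<lambda>j x. indicator {0..T} x * g j x) t"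
proof (cases "t \<in> {..<n} \<rightarrow>\<^sub>E {0..T}")
  case True
  then show ?thesis
    by (auto simp: tensor_def PiE_iff intro!: prod.cong)
next
  case False
  then obtain j where "j < n" "t j \<notin> {0..T}"
    using assms by (auto simp: space_PiM PiE_iff)
  then have "(\<Prod>j<n. indicator {0..T} (t j) * g j (t j)) = 0"
    by (intro prod_zero) (auto intro!: bexI[of _ j])
  with False show ?thesis
    by (simp add: tensor_def)
qed

text \<open>Once the indicator is absorbed into the factors, this is Fubini on the product measure.
  The integrand is measurable before completion, so the completed measure gives the same
  integral.\<close>

lemma subcube_tensor_integral:
  fixes T :: real
  assumes g: "\<And>j. j < n \<Longrightarrow> integrable (lebesgue_on {0..1}) (g j)" and T: "0 < T" "T \<le> 1"
  shows "set_integrable (lebesgue_cube n) ({..<n} \<rightarrow>\<^sub>E {0..T}) (tensor n g)"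
    and "(LINT t:({..<n} \<rightarrow>\<^sub>E {0..T})|lebesgue_cube n. tensor n g t) = (\<Prod>j<n. LINT t|lebesgue_on {0..T}. g j t)"
proof -
  let ?M = "\<Pi>\<^sub>M i\<in>{..<n}. lebesgue_on {0..1::real}" and ?A = "{..<n} \<rightarrow>\<^sub>E {0..T}"
  let ?g = "\<lambda>j x. indicator {0..T} x * g j x"
  interpret product_prob_space "\<lambda>i::nat. lebesgue_on {0..1::real}"
    by (rule product_prob_spaceI[OF prob_space_lebesgue_on_01])
  have "{0..T} \<in> sets (lebesgue_on {0..1})"
    using T by (auto simp: sets_restrict_space_iff)
  then have gi: "integrable (lebesgue_on {0..1}) (?g j)" if "j < n" for j
    using integrable_mult_indicator[OF _ g[OF that]] by simp
  have int: "integrable ?M (tensor n ?g)"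
    unfolding tensor_def[abs_def] by (rule product_integrable_prod) (use gi in auto)
  have val: "(LINT t|?M. tensor n ?g t) = (\<Prod>j<n. LINT t|lebesgue_on {0..1}. ?g j t)"
    unfolding tensor_def[abs_def] by (rule product_integral_prod) (use gi in auto)
  have meas: "(\<lambda>t. indicator ?A t *\<^sub>R tensor n g t) \<in> borel_measurable ?M"
    by (intro borel_measurable_scaleR tensor_measurable_PiM borel_measurable_integrable[OF g]
        borel_measurable_indicator subcube_in_sets T(2))
  have cong: "integrable ?M (\<lambda>t. indicator ?A t *\<^sub>R tensor n g t) = integrable ?M (tensor n ?g)"
    by (rule Bochner_Integration.integrable_cong) (simp_all add: indicator_subcube_mult_tensor)
  show "set_integrable (lebesgue_cube n) ?A (tensor n g)"
    unfolding set_integrable_def lebesgue_cube_def integrable_completion[OF meas] cong by (rule int)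
  have "(LINT t:?A|lebesgue_cube n. tensor n g t) = (LINT t|?M. tensor n ?g t)"
    unfolding set_lebesgue_integral_def lebesgue_cube_def integral_completion[OF meas]
    by (rule Bochner_Integration.integral_cong) (simp_all add: indicator_subcube_mult_tensor)
  also have "\<dots> = (\<Prod>j<n. LINT t|lebesgue_on {0..T}. g j t)"
    unfolding val using T integral_lebesgue_on_initial[of T] by simp
  finally show "(LINT t:?A|lebesgue_cube n. tensor n g t) = (\<Prod>j<n. LINT t|lebesgue_on {0..T}. g j t)" .
qed

text \<open>Each factor integrates to \<open>h k T\<close> by the fundamental theorem. The left-hand
  side mentions only \<open>F\<close>, so the sum on the right is the same for every representation
  of \<open>F\<close>.\<close>

lemma subcube_integral_tensor_powers:
  assumes T: "0 < T" "T \<le> 1" and h: "\<And>k. k < m \<Longrightarrow> h k \<in> cameron_martin"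
    and F: "F \<in> borel_measurable (lebesgue_cube n)"
    and eq: "AE t in lebesgue_cube n. F t = (\<Sum>k<m. a k * tensor_power n (c0_deriv (h k)) t)"
  shows "(LINT t:({..<n} \<rightarrow>\<^sub>E {0..T})|lebesgue_cube n. F t) = (\<Sum>k<m. a k * h k T ^ n)"
proof -
  let ?A = "{..<n} \<rightarrow>\<^sub>E {0..T}"
  have T01: "T \<in> {0..1}" using T by simp
  have A: "?A \<in> sets (lebesgue_cube n)"
    unfolding lebesgue_cube_def using subcube_in_sets[OF T(2)] by auto
  have meas: "tensor_power n (c0_deriv (h k)) \<in> borel_measurable (lebesgue_cube n)" if "k < m" for k
    using cm_deriv_measurable[OF h[OF that]] by (intro tensor_measurable)
  have int: "set_integrable (lebesgue_cube n) ?A (tensor_power n (c0_deriv (h k)))"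
    and val: "(LINT t:?A|lebesgue_cube n. tensor_power n (c0_deriv (h k)) t) = h k T ^ n" if "k < m" for k
    using subcube_tensor_integral[of n "\<lambda>_. c0_deriv (h k)" T] cm_deriv_integrable[OF h[OF that]]
      cm_ftc[OF h[OF that] T01] T by auto
  have "(LINT t:?A|lebesgue_cube n. F t) =
      (LINT t:?A|lebesgue_cube n. (\<Sum>k<m. a k * tensor_power n (c0_deriv (h k)) t))"
    unfolding set_lebesgue_integral_def
  proof (rule integral_cong_AE)
    show "AE t in lebesgue_cube n. indicator ?A t *\<^sub>R F t =
        indicator ?A t *\<^sub>R (\<Sum>k<m. a k * tensor_power n (c0_deriv (h k)) t)"
      using eq by eventually_elim simp
  qed (use A F meas in \<open>auto intro!: borel_measurable_scaleR borel_measurable_sum borel_measurable_times\<close>)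
  also have "\<dots> = (LINT t|lebesgue_cube n. (\<Sum>k<m. a k * (indicator ?A t *\<^sub>R tensor_power n (c0_deriv (h k)) t)))"
    unfolding set_lebesgue_integral_def by (simp add: sum_distrib_left mult_ac)
  also have "\<dots> = (\<Sum>k<m. a k * h k T ^ n)"
    using int val unfolding set_integrable_def set_lebesgue_integral_def
    by (subst Bochner_Integration.integral_sum) (auto intro!: integrable_mult_right)
  finally show ?thesis .
qed

section \<open>Polarization\<close>

text \<open>Expand the product over \<open>N\<close> of \<open>1 + b j\<close>, with
  \<open>b\<close> zero on \<open>A\<close> and -1 elsewhere; \<open>S\<close> is the set of indices
  at which 1 is selected. A factor outside \<open>A\<close> is zero, so the product vanishes unless
  \<open>A = N\<close>.\<close>

lemma alternating_sum_supersets: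
  assumes "finite N" "A \<subseteq> N"
  shows "(\<Sum>S\<in>Pow N. if A \<subseteq> S then (-1) ^ card (N - S) else 0) = (if A = N then 1 else (0::real))"
proof -
  let ?b = "\<lambda>j. if j \<in> A then 0 else (-1::real)"
  have "(\<Prod>j\<in>N. 1 + ?b j) = (\<Sum>S\<in>Pow N. (\<Prod>j\<in>S. 1) * (\<Prod>j\<in>N - S. ?b j))"
    by (rule prod_add[OF assms(1)])
  moreover have "(\<Prod>j\<in>S. 1) * (\<Prod>j\<in>N - S. ?b j) = (if A \<subseteq> S then (-1) ^ card (N - S) else 0)"
    if "S \<in> Pow N" for S
  proof (cases "A \<subseteq> S")
    case True
    then have "(\<Prod>j\<in>N - S. ?b j) = (\<Prod>j\<in>N - S. -1)"
      by (intro prod.cong) auto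
    with True show ?thesis by simp
  next
    case False
    then obtain j where "j \<in> A" "j \<in> N - S"
      using assms(2) by blast
    then have "(\<Prod>j\<in>N - S. ?b j) = 0"
      using assms(1) by (intro prod_zero) auto
    with False show ?thesis by simp
  qed
  moreover have "(\<Prod>j\<in>N. 1 + ?b j) = (if A = N then 1 else 0)"
  proof (cases "A = N")
    case False
    then obtain j where "j \<in> N" "j \<notin> A"
      using assms(2) by blast
    then have "(\<Prod>j\<in>N. 1 + ?b j) = 0"
      using assms(1) by (intro prod_zero) auto
    with False show ?thesis by simp
  qed simp
  ultimately show ?thesis by simp
qed

text \<open>The right-hand side is the permanent of \<open>x\<close>. Expanding the products gives a
  sum over maps \<open>g\<close>, each weighted by the alternating sum over the sets
  \<open>S\<close> containing its image. The weight is zero unless \<open>g\<close> is onto, and a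
  map of the finite set \<open>N\<close> onto itself is a permutation.\<close>

lemma ryser_formula:
  fixes x :: "'a \<Rightarrow> 'a \<Rightarrow> real"
  assumes N: "finite N"
  shows "(\<Sum>S\<in>Pow N. (-1) ^ card (N - S) * (\<Prod>i\<in>N. \<Sum>j\<in>S. x i j)) = (\<Sum>\<sigma> | \<sigma> permutes N. \<Prod>i\<in>N. x i (\<sigma> i))"
proof -
  let ?E = "N \<rightarrow>\<^sub>E N" and ?p = "\<lambda>g. \<Prod>i\<in>N. x i (g i)"
  have E: "finite ?E"
    using N by (intro finite_PiE) auto
  have "(\<Sum>S\<in>Pow N. (-1) ^ card (N - S) * (\<Prod>i\<in>N. \<Sum>j\<in>S. x i j)) =
      (\<Sum>S\<in>Pow N. \<Sum>g\<in>?E. (if g ` N \<subseteq> S then (-1) ^ card (N - S) else 0) * ?p g)"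
  proof (rule sum.cong[OF refl])
    fix S assume S: "S \<in> Pow N"
    then have "finite S" using N finite_subset by blast
    then have "(\<Prod>i\<in>N. \<Sum>j\<in>S. x i j) = (\<Sum>g\<in>N \<rightarrow>\<^sub>E S. ?p g)"
      by (intro prod_sum_PiE N)
    also have "N \<rightarrow>\<^sub>E S = {g \<in> ?E. g ` N \<subseteq> S}"
      using S by (auto simp: PiE_iff extensional_def)
    finally show "(-1) ^ card (N - S) * (\<Prod>i\<in>N. \<Sum>j\<in>S. x i j) =
        (\<Sum>g\<in>?E. (if g ` N \<subseteq> S then (-1) ^ card (N - S) else 0) * ?p g)"
      using E by (simp add: sum_distrib_left sum.inter_filter[symmetric] if_distrib[of "\<lambda>c. c * _"] cong: if_cong)
  qed
  also have "\<dots> = (\<Sum>g\<in>?E. (\<Sum>S\<in>Pow N. if g ` N \<subseteq> S then (-1) ^ card (N - S) else 0) * ?p g)"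
    unfolding sum_distrib_right by (rule sum.swap)
  also have "\<dots> = (\<Sum>g\<in>?E. if g ` N = N then ?p g else 0)"
  proof (rule sum.cong[OF refl])
    fix g assume "g \<in> ?E"
    then have "g ` N \<subseteq> N" by auto
    then show "(\<Sum>S\<in>Pow N. if g ` N \<subseteq> S then (-1) ^ card (N - S) else 0) * ?p g = (if g ` N = N then ?p g else 0)"
      by (subst alternating_sum_supersets[OF N]) auto
  qed
  also have "\<dots> = (\<Sum>g | g \<in> ?E \<and> g ` N = N. ?p g)"
    by (rule sum.inter_filter[OF E, symmetric])
  also have "\<dots> = (\<Sum>\<sigma> | \<sigma> permutes N. ?p \<sigma>)"
  \<comment> \<open>Two conventions outside \<open>N\<close> are matched here: extensional maps are
    \<open>undefined\<close> there, permutations are the identity.\<close>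
  proof (rule sum.reindex_bij_witness[of _ "\<lambda>\<sigma>. restrict \<sigma> N" "\<lambda>g i. if i \<in> N then g i else i"])
    fix g assume g: "g \<in> {g \<in> ?E. g ` N = N}"
    then have "inj_on g N"
      using N by (intro eq_card_imp_inj_on) auto
    then have "bij_betw (\<lambda>i. if i \<in> N then g i else i) N N"
      using g by (auto simp: bij_betw_def inj_on_def image_iff)
    then show "(\<lambda>i. if i \<in> N then g i else i) \<in> {\<sigma>. \<sigma> permutes N}"
      by (simp add: bij_imp_permutes)
    show "restrict (\<lambda>i. if i \<in> N then g i else i) N = g"
      using g by (auto simp: fun_eq_iff PiE_iff extensional_def)
    show "?p (\<lambda>i. if i \<in> N then g i else i) = ?p g"
      by (intro prod.cong) auto
  next
    fix \<sigma> assume \<sigma>: "\<sigma> \<in> {\<sigma>. \<sigma> permutes N}"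
    show "restrict \<sigma> N \<in> {g \<in> ?E. g ` N = N}"
      using \<sigma> permutes_image[of \<sigma> N] by (auto simp: permutes_in_image)
    show "(\<lambda>i. if i \<in> N then restrict \<sigma> N i else i) = \<sigma>"
      using \<sigma> by (auto simp: fun_eq_iff permutes_not_in)
  qed
  finally show ?thesis .
qed

text \<open>Up to \<open>fact n\<close>, the symmetric tensor at \<open>t\<close> is the permanent
  of the matrix with entries \<open>f j (t i)\<close>; in Ryser's formula for it the row sums over
  \<open>S\<close> form a tensor power.\<close>

lemma sym_tensor_polarization:
  "sym_tensor n f t =
    (\<Sum>S\<in>Pow {..<n}. (-1) ^ card ({..<n} - S) / fact n * tensor_power n (\<lambda>s. \<Sum>j\<in>S. f j s) t)"
proof -
  have "(\<Sum>\<sigma> | \<sigma> permutes {..<n}. tensor n (\<lambda>j. f (inv \<sigma> j)) t) =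
      (\<Sum>\<sigma> | \<sigma> permutes {..<n}. \<Prod>i<n. f (\<sigma> i) (t i))"
    unfolding tensor_def by (rule sum_permutations_inverse[symmetric])
  also have "\<dots> = (\<Sum>S\<in>Pow {..<n}. (-1) ^ card ({..<n} - S) * tensor_power n (\<lambda>s. \<Sum>j\<in>S. f j s) t)"
    unfolding tensor_def by (rule ryser_formula[symmetric]) simp
  finally show ?thesis
    unfolding sym_tensor_def by (simp add: sum_distrib_left)
qed

text \<open>The empty sum is reached as \<open>0 *\<^sub>R h0 + 0 *\<^sub>R h0\<close>, which is why
  some element \<open>h0\<close> is supplied.\<close>

lemma sum_in_cameron_martin_dual:
  assumes sets: "sets \<mu> = sets borel" and "h0 \<in> cameron_martin_dual \<mu>"
    and "finite S" "\<And>j. j \<in> S \<Longrightarrow> h j \<in> cameron_martin_dual \<mu>"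
  shows "sum h S \<in> cameron_martin_dual \<mu> \<and>
    (AE t in lebesgue_on {0..1}. c0_deriv (sum h S) t = (\<Sum>j\<in>S. c0_deriv (h j) t))"
  using assms(3,4)
proof (induction S rule: finite_induct)
  case empty
  have "h0 \<in> cameron_martin"
    using assms(2) by (simp add: cameron_martin_dual_def)
  then show ?case
    using cameron_martin_dual_lincomb[OF sets assms(2,2), of 0 0] c0_deriv_lincomb_AE[of h0 h0 0 0] by simp
next
  case (insert j S)
  then have j: "h j \<in> cameron_martin_dual \<mu>" and S: "sum h S \<in> cameron_martin_dual \<mu>"
    and AE: "AE t in lebesgue_on {0..1}. c0_deriv (sum h S) t = (\<Sum>j\<in>S. c0_deriv (h j) t)"
    by auto
  have "AE t in lebesgue_on {0..1}. c0_deriv (1 *\<^sub>R h j + 1 *\<^sub>R sum h S) t = 1 * c0_deriv (h j) t + 1 * c0_deriv (sum h S) t"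
    using j S by (intro c0_deriv_lincomb_AE) (auto simp: cameron_martin_dual_def)
  then show ?case
    using AE cameron_martin_dual_lincomb[OF sets j S, of 1 1] insert(1,2) by (auto elim!: eventually_elim2)
qed

section \<open>Existence of the multiple Ito integral\<close>

definition has_multiple_ito :: "c0 measure \<Rightarrow> nat \<Rightarrow> ((nat \<Rightarrow> real) \<Rightarrow> real) \<Rightarrow> bool" where
  "has_multiple_ito \<mu> n F \<longleftrightarrow> (\<exists>\<Phi>. is_multiple_ito \<mu> n F \<Phi>)"

text \<open>Every element of the dual carries a functional, so existence concerns only the
  representation of \<open>F\<close> by tensor powers.\<close>

lemma has_multiple_ito_iff:
  "has_multiple_ito \<mu> n F \<longleftrightarrow>
    (\<exists>(m::nat) a h. (\<forall>k<m. h k \<in> cameron_martin_dual \<mu>) \<and>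
      (AE t in lebesgue_cube n. F t = (\<Sum>k<m. a k * tensor_power n (c0_deriv (h k)) t)))"
proof
  assume "has_multiple_ito \<mu> n F"
  then show "\<exists>(m::nat) a h. (\<forall>k<m. h k \<in> cameron_martin_dual \<mu>) \<and>
      (AE t in lebesgue_cube n. F t = (\<Sum>k<m. a k * tensor_power n (c0_deriv (h k)) t))"
    unfolding has_multiple_ito_def is_multiple_ito_def by blast
next
  assume "\<exists>(m::nat) a h. (\<forall>k<m. h k \<in> cameron_martin_dual \<mu>) \<and>
      (AE t in lebesgue_cube n. F t = (\<Sum>k<m. a k * tensor_power n (c0_deriv (h k)) t))"
  then obtain m :: nat and a h where h: "\<And>k. k < m \<Longrightarrow> h k \<in> cameron_martin_dual \<mu>"
    and F: "AE t in lebesgue_cube n. F t = (\<Sum>k<m. a k * tensor_power n (c0_deriv (h k)) t)"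
    by blast
  have "\<exists>\<phi>. is_I_functional \<mu> (h k) \<phi>" if "k < m" for k
    using h[OF that] by (simp add: cameron_martin_dual_def)
  then obtain \<phi> where \<phi>: "\<And>k. k < m \<Longrightarrow> is_I_functional \<mu> (h k) (\<phi> k)"
    by metis
  let ?\<Phi> = "\<lambda>\<omega>. \<Sum>k<m. a k * hermite n (\<phi> k \<omega>) (LINT t|lebesgue_on {0..1}. (c0_deriv (h k) t)\<^sup>2)"
  have "is_multiple_ito \<mu> n F ?\<Phi>"
    unfolding is_multiple_ito_def
    by (rule exI[of _ m], rule exI[of _ a], rule exI[of _ h], rule exI[of _ \<phi>]) (use h \<phi> F in blast)
  then show "has_multiple_ito \<mu> n F"
    unfolding has_multiple_ito_def by blast
qed

lemma has_multiple_ito_cong: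
  assumes "has_multiple_ito \<mu> n F" "AE t in lebesgue_cube n. G t = F t"
  shows "has_multiple_ito \<mu> n G"
proof -
  obtain m :: nat and a h where h: "\<forall>k<m. h k \<in> cameron_martin_dual \<mu>"
    and F: "AE t in lebesgue_cube n. F t = (\<Sum>k<m. a k * tensor_power n (c0_deriv (h k)) t)"
    using assms(1) unfolding has_multiple_ito_iff by blast
  have "AE t in lebesgue_cube n. G t = (\<Sum>k<m. a k * tensor_power n (c0_deriv (h k)) t)"
    using F assms(2) by eventually_elim simp
  with h show ?thesis
    unfolding has_multiple_ito_iff by blast
qed

lemma has_multiple_ito_power:
  assumes "h \<in> cameron_martin_dual \<mu>"
  shows "has_multiple_ito \<mu> n (tensor_power n (c0_deriv h))"
  unfolding has_multiple_ito_iff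
  by (rule exI[of _ 1], rule exI[of _ "\<lambda>_. 1"], rule exI[of _ "\<lambda>_. h"]) (simp add: assms)

lemma has_multiple_ito_zero: "has_multiple_ito \<mu> n (\<lambda>_. 0)"
  unfolding has_multiple_ito_iff by (rule exI[of _ 0]) simp

lemma has_multiple_ito_scale:
  assumes "has_multiple_ito \<mu> n F"
  shows "has_multiple_ito \<mu> n (\<lambda>t. c * F t)"
proof -
  obtain m :: nat and a h where h: "\<forall>k<m. h k \<in> cameron_martin_dual \<mu>"
    and F: "AE t in lebesgue_cube n. F t = (\<Sum>k<m. a k * tensor_power n (c0_deriv (h k)) t)"
    using assms unfolding has_multiple_ito_iff by blast
  have "AE t in lebesgue_cube n. c * F t = (\<Sum>k<m. c * a k * tensor_power n (c0_deriv (h k)) t)"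
    using F by eventually_elim (simp add: sum_distrib_left mult.assoc)
  with h show ?thesis
    unfolding has_multiple_ito_iff by (intro exI[of _ m] exI[of _ "\<lambda>k. c * a k"] exI[of _ h] conjI)
qed

lemma has_multiple_ito_add:
  assumes "has_multiple_ito \<mu> n F" "has_multiple_ito \<mu> n G"
  shows "has_multiple_ito \<mu> n (\<lambda>t. F t + G t)"
proof -
  obtain m :: nat and a h where h: "\<forall>k<m. h k \<in> cameron_martin_dual \<mu>"
    and F: "AE t in lebesgue_cube n. F t = (\<Sum>k<m. a k * tensor_power n (c0_deriv (h k)) t)"
    using assms(1) unfolding has_multiple_ito_iff by blast
  obtain m' :: nat and a' h' where h': "\<forall>k<m'. h' k \<in> cameron_martin_dual \<mu>"
    and G: "AE t in lebesgue_cube n. G t = (\<Sum>k<m'. a' k * tensor_power n (c0_deriv (h' k)) t)"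
    using assms(2) unfolding has_multiple_ito_iff by blast
  let ?a = "\<lambda>k. if k < m then a k else a' (k - m)" and ?h = "\<lambda>k. if k < m then h k else h' (k - m)"
  have split: "(\<Sum>k<m + m'. f k) = (\<Sum>k<m. f k) + (\<Sum>k<m'. f (m + k))" for f :: "nat \<Rightarrow> real"
    by (induction m') (auto simp: add.assoc)
  have "AE t in lebesgue_cube n. F t + G t = (\<Sum>k<m + m'. ?a k * tensor_power n (c0_deriv (?h k)) t)"
    using F G by eventually_elim (simp add: split)
  moreover have "\<forall>k<m + m'. ?h k \<in> cameron_martin_dual \<mu>"
    using h h' by auto
  ultimately show ?thesis
    unfolding has_multiple_ito_iff by (intro exI[of _ "m + m'"] exI[of _ ?a] exI[of _ ?h] conjI)
qed

lemma has_multiple_ito_sum: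
  assumes "finite I" "\<And>i. i \<in> I \<Longrightarrow> has_multiple_ito \<mu> n (F i)"
  shows "has_multiple_ito \<mu> n (\<lambda>t. \<Sum>i\<in>I. F i t)"
  using assms by (induction I rule: finite_induct) (auto intro: has_multiple_ito_zero has_multiple_ito_add)

text \<open>Polarization yields powers of sums of derivatives. Such a sum is the derivative of the
  sum path up to a null set, so its power agrees almost everywhere on the cube with an admissible
  one.\<close>

lemma has_multiple_ito_sym_tensor:
  assumes sets: "sets \<mu> = sets borel" and "n \<ge> 1" and h: "\<And>j. j < n \<Longrightarrow> h j \<in> cameron_martin_dual \<mu>"
  shows "has_multiple_ito \<mu> n (sym_tensor n (\<lambda>j. c0_deriv (h j)))"
proof -
  have h0: "h 0 \<in> cameron_martin_dual \<mu>"
    using \<open>n \<ge> 1\<close> by (intro h) simp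
  have "has_multiple_ito \<mu> n (tensor_power n (\<lambda>s. \<Sum>j\<in>S. c0_deriv (h j) s))" if S: "S \<in> Pow {..<n}" for S
  proof -
    have dual: "sum h S \<in> cameron_martin_dual \<mu>"
      and AE: "AE s in lebesgue_on {0..1}. c0_deriv (sum h S) s = (\<Sum>j\<in>S. c0_deriv (h j) s)"
      using sum_in_cameron_martin_dual[OF sets h0, of S h] S h finite_subset[of S "{..<n}"] by auto
    \<comment> \<open>The exceptional null set on the interval gives a null set of the cube for each
      coordinate, and there are only finitely many coordinates.\<close>
    have "AE t in lebesgue_cube n. \<forall>i<n. c0_deriv (sum h S) (t i) = (\<Sum>j\<in>S. c0_deriv (h j) (t i))"
      using AE_lebesgue_cube_component[OF AE] by (subst AE_all_countable) (auto simp: AE_impI)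
    then have "AE t in lebesgue_cube n. tensor_power n (\<lambda>s. \<Sum>j\<in>S. c0_deriv (h j) s) t =
        tensor_power n (c0_deriv (sum h S)) t"
      by eventually_elim (simp add: tensor_def)
    then show ?thesis
      by (rule has_multiple_ito_cong[OF has_multiple_ito_power[OF dual]])
  qed
  then show ?thesis
    unfolding sym_tensor_polarization[abs_def] by (intro has_multiple_ito_sum has_multiple_ito_scale) auto
qed

lemma has_multiple_ito_sym_tensor_combination:
  assumes sets: "sets \<mu> = sets borel" and "n \<ge> 1" and "sym_tensor_combination \<mu> n F"
  shows "has_multiple_ito \<mu> n F"
proof -
  obtain m :: nat and a h where h: "\<And>k j. k < m \<Longrightarrow> j < n \<Longrightarrow> h k j \<in> cameron_martin_dual \<mu>"
    and F: "AE t in lebesgue_cube n. F t = (\<Sum>k<m. a k * sym_tensor n (\<lambda>j. c0_deriv (h k j)) t)"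
    using assms(3) unfolding sym_tensor_combination_def by blast
  have "has_multiple_ito \<mu> n (\<lambda>t. \<Sum>k<m. a k * sym_tensor n (\<lambda>j. c0_deriv (h k j)) t)"
    using h by (intro has_multiple_ito_sum has_multiple_ito_scale has_multiple_ito_sym_tensor sets \<open>n \<ge> 1\<close>) auto
  then show ?thesis
    by (rule has_multiple_ito_cong[OF _ F])
qed

section \<open>The Gaussian Radon transform of Hermite functionals\<close>

context
  fixes \<mu> \<nu> :: "c0 measure" and T c :: real
  assumes sets: "sets \<mu> = sets borel" and T: "0 < T" "T \<le> 1"
    and cond: "conditioned_measure \<mu> (level_subspace T c) \<nu>"
begin

text \<open>The characteristic function of \<open>\<phi>\<close> at \<open>s\<close> is the formula
  of the conditioned measure for \<open>s *\<^sub>R h\<close>, whose functional is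
  \<open>s * \<phi>\<close>. The variance is nonnegative, being the squared norm of a
  projection.\<close>

lemma conditioned_measure_distr:
  assumes h: "h \<in> cameron_martin" "is_I_functional \<mu> h \<phi>"
  shows "distr \<nu> borel \<phi> = distr std_normal_distribution borel
    (\<lambda>z. c * h T / T + sqrt (cm_inner h h - (h T)\<^sup>2 / T) * z)"
proof -
  have \<nu>: "prob_space \<nu>" "sets \<nu> = sets borel"
    using cond by (auto simp: conditioned_measure_def)
  have \<phi>: "\<phi> \<in> borel_measurable \<nu>"
    using h(2) \<nu>(2) by (intro bounded_linear_borel_measurable) (simp_all add: is_I_functional_def)
  have v: "cm_inner h h - (h T)\<^sup>2 / T \<ge> 0"
    using cm_norm_proj_level_subspace[OF T h(1)] by (metis zero_le_power2)
  show ?thesis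
  proof (rule prob_space.distr_eq_gaussian[OF \<nu>(1) \<phi> v])
    fix s :: real
    have sh: "s *\<^sub>R h \<in> cameron_martin" "is_I_functional \<mu> (s *\<^sub>R h) (\<lambda>\<omega>. s * \<phi> \<omega>)"
      using cameron_martin_scaleR[OF h(1)] is_I_functional_lincomb[OF sets h h, of s 0] by simp_all
    have inner: "cm_inner (s *\<^sub>R h) (s *\<^sub>R h) = s\<^sup>2 * cm_inner h h"
      using cm_inner_lincomb_left[OF h(1) h(1) sh(1), of s 0] cm_inner_lincomb_right[OF h(1) h(1) h(1), of s 0]
      by (simp add: power2_eq_square)
    have "c * (s *\<^sub>R h) T / T = s * (c * h T / T)"
      by simp
    moreover have "(cm_inner (s *\<^sub>R h) (s *\<^sub>R h) - ((s *\<^sub>R h) T)\<^sup>2 / T) / 2 = s\<^sup>2 * (cm_inner h h - (h T)\<^sup>2 / T) / 2"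
      unfolding inner by (simp add: power_mult_distrib algebra_simps)
    ultimately show "(CLINT \<omega>|\<nu>. exp (\<i> * complex_of_real (s * \<phi> \<omega>))) =
        exp (\<i> * complex_of_real (s * (c * h T / T)) -
          complex_of_real (s\<^sup>2 * (cm_inner h h - (h T)\<^sup>2 / T) / 2))"
      using conditioned_measure_char[OF T cond sh] by (simp only:)
  qed
qed

lemma hermite_functional_transform:
  assumes h: "h \<in> cameron_martin" "is_I_functional \<mu> h \<phi>"
  shows "integrable \<nu> (\<lambda>\<omega>. hermite n (\<phi> \<omega>) (cm_inner h h))"
    and "(LINT \<omega>|\<nu>. hermite n (\<phi> \<omega>) (cm_inner h h)) = h T ^ n * hermite n (c / T) (1 / T)"
proof -
  let ?v = "cm_inner h h - (h T)\<^sup>2 / T" and ?H = "\<lambda>x. hermite n x (cm_inner h h)"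
  have \<nu>: "sets \<nu> = sets borel"
    using cond by (auto simp: conditioned_measure_def)
  have \<phi> [measurable]: "\<phi> \<in> borel_measurable \<nu>"
    using h(2) \<nu> by (intro bounded_linear_borel_measurable) (simp_all add: is_I_functional_def)
  \<comment> \<open>Expanding around 0 exhibits the Hermite function as a polynomial.\<close>
  have H [measurable]: "?H \<in> borel_measurable borel"
    using hermite_add[of n 0 _ "cm_inner h h"] by simp
  have v: "?v \<ge> 0"
    using cm_norm_proj_level_subspace[OF T h(1)] by (metis zero_le_power2)
  have "integrable (distr \<nu> borel \<phi>) ?H"
    unfolding conditioned_measure_distr[OF h]
    by (subst integrable_distr_eq) (auto intro: integrable_hermite_gaussian)
  then show "integrable \<nu> (\<lambda>\<omega>. ?H (\<phi> \<omega>))"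
    by (subst (asm) integrable_distr_eq) auto
  have "(LINT \<omega>|\<nu>. ?H (\<phi> \<omega>)) = (LINT x|distr \<nu> borel \<phi>. ?H x)"
    by (subst integral_distr) auto
  also have "\<dots> = (LINT z|std_normal_distribution. ?H (c * h T / T + sqrt ?v * z))"
    unfolding conditioned_measure_distr[OF h] by (subst integral_distr) auto
  also have "\<dots> = hermite n (h T * (c / T)) ((h T)\<^sup>2 * (1 / T))"
    unfolding integral_hermite_gaussian using v by (simp add: mult.commute)
  also have "\<dots> = h T ^ n * hermite n (c / T) (1 / T)"
    by (rule hermite_scale)
  finally show "(LINT \<omega>|\<nu>. ?H (\<phi> \<omega>)) = h T ^ n * hermite n (c / T) (1 / T)" .
qed

lemma multiple_ito_transform:
  assumes F: "F \<in> borel_measurable (lebesgue_cube n)" and "is_multiple_ito \<mu> n F \<Phi>"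
  shows "integrable \<nu> \<Phi> \<and> gaussian_radon_transform \<nu> \<Phi> =
    (LINT t:({..<n} \<rightarrow>\<^sub>E {0..T})|lebesgue_cube n. F t) * hermite n (c / T) (1 / T)"
proof -
  obtain m :: nat and a h \<phi> where
    h: "\<And>k. k < m \<Longrightarrow> h k \<in> cameron_martin" "\<And>k. k < m \<Longrightarrow> is_I_functional \<mu> (h k) (\<phi> k)"
    and eq: "AE t in lebesgue_cube n. F t = (\<Sum>k<m. a k * tensor_power n (c0_deriv (h k)) t)"
    and \<Phi>: "\<Phi> = (\<lambda>\<omega>. \<Sum>k<m. a k * hermite n (\<phi> k \<omega>) (cm_inner (h k) (h k)))"
    using assms(2) unfolding is_multiple_ito_def cm_inner_def cameron_martin_dual_def power2_eq_square by blast
  have int: "integrable \<nu> (\<lambda>\<omega>. a k * hermite n (\<phi> k \<omega>) (cm_inner (h k) (h k)))" if "k < m" for k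
    by (intro integrable_mult_right hermite_functional_transform h that)
  have "gaussian_radon_transform \<nu> \<Phi> =
      (\<Sum>k<m. a k * (LINT \<omega>|\<nu>. hermite n (\<phi> k \<omega>) (cm_inner (h k) (h k))))"
    unfolding gaussian_radon_transform_def \<Phi> using int by (subst Bochner_Integration.integral_sum) auto
  also have "\<dots> = (\<Sum>k<m. a k * h k T ^ n) * hermite n (c / T) (1 / T)"
    using h by (simp add: hermite_functional_transform sum_distrib_right mult.assoc)
  also have "(\<Sum>k<m. a k * h k T ^ n) = (LINT t:({..<n} \<rightarrow>\<^sub>E {0..T})|lebesgue_cube n. F t)"
    by (rule subcube_integral_tensor_powers[OF T h(1) F eq, symmetric])
  finally show ?thesis
    unfolding \<Phi> using int by (auto intro!: Bochner_Integration.integrable_sum)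
qed

end

theorem mainTheorem2:
  fixes \<mu> \<nu> :: "c0 measure" and T c :: real and n :: nat
  assumes "wiener_measure \<mu>"
    and "0 < T" and "T \<le> 1" and "n \<ge> 1"
    and "conditioned_measure \<mu> (level_subspace T c) \<nu>"
  shows
    "(\<forall>F\<in>L2_cube n. sym_tensor_combination \<mu> n F \<longrightarrow>
        (\<exists>\<Phi>. is_multiple_ito \<mu> n F \<Phi>) \<and>
        (\<forall>\<Phi>. is_multiple_ito \<mu> n F \<Phi> \<longrightarrow>
           integrable \<nu> \<Phi> \<and>
           gaussian_radon_transform \<nu> \<Phi> =
             (LINT t:({..<n} \<rightarrow>\<^sub>E {0..T})|lebesgue_cube n. F t) * hermite n (c / T) (1 / T))) \<and>
     (\<forall>h\<in>cameron_martin_dual \<mu>.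
        (\<exists>\<Phi>. is_multiple_ito \<mu> n (tensor_power n (c0_deriv h)) \<Phi>) \<and>
        (\<forall>\<Phi>. is_multiple_ito \<mu> n (tensor_power n (c0_deriv h)) \<Phi> \<longrightarrow>
           integrable \<nu> \<Phi> \<and>
           gaussian_radon_transform \<nu> \<Phi> =
             (LINT t|lebesgue_on {0..T}. c0_deriv h t) ^ n * hermite n (c / T) (1 / T)))"
proof -
  have sets: "sets \<mu> = sets borel"
    using assms(1) by (simp add: wiener_measure_def)
  note transform = multiple_ito_transform[OF sets assms(2,3,5)]
  show ?thesis
  proof (intro conjI ballI impI)
    fix F assume "F \<in> L2_cube n" "sym_tensor_combination \<mu> n F"
    then show "\<exists>\<Phi>. is_multiple_ito \<mu> n F \<Phi>"
      and "\<forall>\<Phi>. is_multiple_ito \<mu> n F \<Phi> \<longrightarrow> integrable \<nu> \<Phi> \<and> gaussian_radon_transform \<nu> \<Phi> =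
        (LINT t:({..<n} \<rightarrow>\<^sub>E {0..T})|lebesgue_cube n. F t) * hermite n (c / T) (1 / T)"
      using has_multiple_ito_sym_tensor_combination[OF sets assms(4), of F] transform
      by (auto simp: has_multiple_ito_def L2_cube_def)
  next
    fix h assume h: "h \<in> cameron_martin_dual \<mu>"
    then have cm: "h \<in> cameron_martin"
      by (simp add: cameron_martin_dual_def)
    show "\<exists>\<Phi>. is_multiple_ito \<mu> n (tensor_power n (c0_deriv h)) \<Phi>"
      using has_multiple_ito_power[OF h] by (simp add: has_multiple_ito_def)
    have "tensor_power n (c0_deriv h) \<in> borel_measurable (lebesgue_cube n)"
      by (intro tensor_measurable cm_deriv_measurable cm)
    moreover have "(LINT t:({..<n} \<rightarrow>\<^sub>E {0..T})|lebesgue_cube n. tensor_power n (c0_deriv h) t) =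
        (LINT t|lebesgue_on {0..T}. c0_deriv h t) ^ n"
      using subcube_tensor_integral(2)[of n "\<lambda>_. c0_deriv h" T] cm_deriv_integrable[OF cm] assms(2,3) by simp
    ultimately show "\<forall>\<Phi>. is_multiple_ito \<mu> n (tensor_power n (c0_deriv h)) \<Phi> \<longrightarrow>
        integrable \<nu> \<Phi> \<and> gaussian_radon_transform \<nu> \<Phi> =
          (LINT t|lebesgue_on {0..T}. c0_deriv h t) ^ n * hermite n (c / T) (1 / T)"
      using transform[of "tensor_power n (c0_deriv h)" n] by simp
  qed
qed

end
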